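(* Let $b_1>0$ be arbitrary, and set $$a_1:=2b_1\left[\frac{4 l_2\kappa }{l_1^2} + \max\left(\sqrt{\frac{\alpha_1}{\rho}}+\frac{\gamma^2\sqrt{\beta\mu}}{\rho},\;2\sqrt{\frac{\beta}{\mu}}\right)\right],\qquad M:=b_1 l_2\tilde M,$$ $$\tilde M:=\left[\frac{8l_2\kappa }{l_1^2} +2 \max\left(\sqrt{\frac{\alpha_1}{\rho}}+\frac{\gamma^2\sqrt{\beta\mu}}{\rho},\;2\sqrt{\frac{\beta}{\mu}}\right)\right]\cdot\max \left[\sqrt{\frac{\rho}{\alpha_1}}+ \sqrt{\frac{\mu\gamma^2}{\alpha_1}},\;\sqrt{\frac{\mu}{\beta}}+\sqrt{\frac{\mu\gamma^2}{\alpha_1}},\; 2,\; \frac{\alpha}{\alpha_1}+\frac{\gamma^2\beta}{2\alpha_1}\right].$$ Let $\delta>0$ be a constant with $$\delta <\min \left(\frac{1}{M},\;\frac{2\xi_1}{a_1l_2 \left(\rho+\xi_1^2\frac{2}{\alpha_1}\right)},\;\frac{2\xi_2}{a_1l_2 \left(\mu+\xi_2^2\frac{\alpha+\gamma^2\beta}{\alpha_1\beta}\right)}\right).$$ Then, along every solution of the static closed-loop system, the energy $E(t)$ decays exponentially with decay rate $\sigma:=\delta (1-M\delta) \frac{8 b_1 l_2\kappa}{l_1^2}$, namely $$E(t)\le\frac{1+M\delta}{1-M\delta}\, e^{-\sigma t} E(0), \qquad \forall t>0.$$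
   Context: Parameters: $l_1,l_2,\kappa,\rho,\mu,\alpha_1,\beta,\gamma>0$ are given constants and $\alpha:=\alpha_1+\gamma^2\beta$. The feedback gains satisfy $\xi_1,\xi_2>0$. All functions are real-valued. Static closed-loop system (heat equation on $(-l_1,0)$ coupled to a magnetizable piezoelectric beam on $(0,l_2)$, written in first-order form; $z$ is the temperature, $u_1=v_x$, $u_2=p_x$, $w_1=v_t$, $w_2=p_t$, where $v$ is the longitudinal displacement and $p$ the total charge): for $t>0$, - $z_t=\kappa z_{xx}$ on $(-l_1,0)$; - $u_{1,t}=w_{1,x}$, $u_{2,t}=w_{2,x}$, $\rho w_{1,t}=\alpha u_{1,x}-\gamma\beta u_{2,x}$, $\mu w_{2,t}=-\gamma\beta u_{1,x}+\beta u_{2,x}$ on $(0,l_2)$; - $z(-l_1,t)=0$, $w_2(0,t)=0$, $z(0,t)=w_1(0,t)$, $\kappa z_x(0,t)=\alpha u_1(0,t)-\gamma\beta u_2(0,t)$; - $\alpha u_1(l_2,t)-\gamma\beta u_2(l_2,t)=-\xi_1 w_1(l_2,t)$, $-\gamma\beta u_1(l_2,t)+\beta u_2(l_2,t)=-\xi_2 w_2(l_2,t)$; - initial data $(z,u_1,u_2,w_1,w_2)(\cdot,0)$ prescribed. Energy space: $\mathrm H=L^2(-l_1,0)\times[L^2(0,l_2)]^4$. A classical solution has $z\in C^1([0,\infty);L^2)\cap C([0,\infty);H^2)$ and $u_i,w_i\in C^1([0,\infty);L^2)\cap C([0,\infty);H^1)$. A solution is a classical solution or, for initial data in $\mathrm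 H$, a limit of classical solutions in $C([0,T];\mathrm H)$ for every $T>0$. Energy: $$E(t)=\frac12\int_0^{l_1}|z(-x,t)|^2dx+\frac12\int_0^{l_2}\left[\rho|w_1|^2+\mu|w_2|^2+\alpha_1|u_1|^2+\beta|\gamma u_1-u_2|^2\right](x,t)\,dx.$$ *)

theory Defs
  imports "HOL-Analysis.Analysis"
begin

(* Elements of L^2(a,b), H^1(a,b), H^2(a,b) are represented by actual functions real => real,
   of which only the values on [a,b] matter (the endpoints form a null set).
   A time-dependent field is a function f :: real => real => real, with f t x its value at
   time t and position x; only times t >= 0 matter. *)

definition L2 :: "real \<Rightarrow> real \<Rightarrow> (real \<Rightarrow> real) set" where
  "L2 a b = {f. f \<in> borel_measurable (lebesgue_on {a..b}) \<and>
                integrable (lebesgue_on {a..b}) (\<lambda>x. (f x)\<^sup>2)}"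

definition L2_norm :: "real \<Rightarrow> real \<Rightarrow> (real \<Rightarrow> real) \<Rightarrow> real" where
  "L2_norm a b f = sqrt (LINT x|lebesgue_on {a..b}. (f x)\<^sup>2)"

(* phi is a C^1 function with compact support in the open interval (a,b), with derivative phi'. *)
definition test_fun :: "real \<Rightarrow> real \<Rightarrow> (real \<Rightarrow> real) \<Rightarrow> (real \<Rightarrow> real) \<Rightarrow> bool" where
  "test_fun a b \<phi> \<phi>' \<longleftrightarrow>
     (\<forall>x. (\<phi> has_real_derivative \<phi>' x) (at x)) \<and> continuous_on UNIV \<phi>' \<and>
     (\<exists>c d. a < c \<and> d < b \<and> (\<forall>x. x \<notin> {c..d} \<longrightarrow> \<phi> x = 0))"

definition weak_deriv :: "real \<Rightarrow> real \<Rightarrow> (real \<Rightarrow> real) \<Rightarrow> (real \<Rightarrow> real) \<Rightarrow> bool" where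
  "weak_deriv a b f g \<longleftrightarrow>
     (\<forall>\<phi> \<phi>'. test_fun a b \<phi> \<phi>' \<longrightarrow>
        (LINT x|lebesgue_on {a..b}. f x * \<phi>' x) = - (LINT x|lebesgue_on {a..b}. g x * \<phi> x))"

(* f is in H^1(a,b) with weak derivative f'.  Every class in H^1(a,b) has a unique representative
   that is continuous on [a,b]; we take f to be that one, so that f a and f b are the traces. *)
definition H1 :: "real \<Rightarrow> real \<Rightarrow> (real \<Rightarrow> real) \<Rightarrow> (real \<Rightarrow> real) \<Rightarrow> bool" where
  "H1 a b f f' \<longleftrightarrow>
     f \<in> L2 a b \<and> f' \<in> L2 a b \<and> weak_deriv a b f f' \<and> continuous_on {a..b} f"

(* f is in C([0,infinity); L^2(a,b)) *)
definition C0_L2 :: "real \<Rightarrow> real \<Rightarrow> (real \<Rightarrow> real \<Rightarrow> real) \<Rightarrow> bool" where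
  "C0_L2 a b f \<longleftrightarrow>
     (\<forall>t\<ge>0. f t \<in> L2 a b) \<and>
     (\<forall>t\<ge>0. ((\<lambda>s. L2_norm a b (\<lambda>x. f s x - f t x)) \<longlongrightarrow> 0) (at t within {0..}))"

(* f is in C^1([0,infinity); L^2(a,b)) with time derivative ft (one-sided at time 0) *)
definition C1_L2 :: "real \<Rightarrow> real \<Rightarrow> (real \<Rightarrow> real \<Rightarrow> real) \<Rightarrow> (real \<Rightarrow> real \<Rightarrow> real) \<Rightarrow> bool" where
  "C1_L2 a b f ft \<longleftrightarrow>
     (\<forall>t\<ge>0. f t \<in> L2 a b) \<and>
     (\<forall>t\<ge>0. ((\<lambda>s. L2_norm a b (\<lambda>x. (f s x - f t x) / (s - t) - ft t x)) \<longlongrightarrow> 0)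
              (at t within {0..})) \<and>
     C0_L2 a b ft"

(* f is in C([0,infinity); H^1(a,b)) with space derivative fx.  The squared H^1 norm is the sum of
   the squared L^2 norms of f and fx, so continuity in H^1 is L^2 continuity of f and fx. *)
definition C0_H1 :: "real \<Rightarrow> real \<Rightarrow> (real \<Rightarrow> real \<Rightarrow> real) \<Rightarrow> (real \<Rightarrow> real \<Rightarrow> real) \<Rightarrow> bool" where
  "C0_H1 a b f fx \<longleftrightarrow> (\<forall>t\<ge>0. H1 a b (f t) (fx t)) \<and> C0_L2 a b f \<and> C0_L2 a b fx"

(* f is in C([0,infinity); H^2(a,b)) with space derivatives fx and fxx *)
definition C0_H2 :: "real \<Rightarrow> real \<Rightarrow> (real \<Rightarrow> real \<Rightarrow> real) \<Rightarrow> (real \<Rightarrow> real \<Rightarrow> real) \<Rightarrow>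
    (real \<Rightarrow> real \<Rightarrow> real) \<Rightarrow> bool" where
  "C0_H2 a b f fx fxx \<longleftrightarrow> C0_H1 a b f fx \<and> C0_H1 a b fx fxx"

definition classical_solution ::
  "real \<Rightarrow> real \<Rightarrow> real \<Rightarrow> real \<Rightarrow> real \<Rightarrow> real \<Rightarrow> real \<Rightarrow> real \<Rightarrow> real \<Rightarrow> real \<Rightarrow>
   (real \<Rightarrow> real \<Rightarrow> real) \<Rightarrow> (real \<Rightarrow> real \<Rightarrow> real) \<Rightarrow> (real \<Rightarrow> real \<Rightarrow> real) \<Rightarrow>
   (real \<Rightarrow> real \<Rightarrow> real) \<Rightarrow> (real \<Rightarrow> real \<Rightarrow> real) \<Rightarrow> bool" where
  "classical_solution l1 l2 \<kappa> \<rho> \<mu> \<alpha> \<beta> \<gamma> \<xi>1 \<xi>2 z u1 u2 w1 w2 \<longleftrightarrow>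
    (\<exists>zt zx zxx u1t u1x u2t u2x w1t w1x w2t w2x.
       C1_L2 (- l1) 0 z zt \<and> C0_H2 (- l1) 0 z zx zxx \<and>
       C1_L2 0 l2 u1 u1t \<and> C0_H1 0 l2 u1 u1x \<and>
       C1_L2 0 l2 u2 u2t \<and> C0_H1 0 l2 u2 u2x \<and>
       C1_L2 0 l2 w1 w1t \<and> C0_H1 0 l2 w1 w1x \<and>
       C1_L2 0 l2 w2 w2t \<and> C0_H1 0 l2 w2 w2x \<and>
       (\<forall>t>0.
          (AE x in lebesgue_on {- l1..0}. zt t x = \<kappa> * zxx t x) \<and>
          (AE x in lebesgue_on {0..l2}. u1t t x = w1x t x) \<and>
          (AE x in lebesgue_on {0..l2}. u2t t x = w2x t x) \<and>
          (AE x in lebesgue_on {0..l2}. \<rho> * w1t t x = \<alpha> * u1x t x - \<gamma> * \<beta> * u2x t x) \<and>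
          (AE x in lebesgue_on {0..l2}. \<mu> * w2t t x = - \<gamma> * \<beta> * u1x t x + \<beta> * u2x t x) \<and>
          z t (- l1) = 0 \<and> w2 t 0 = 0 \<and> z t 0 = w1 t 0 \<and>
          \<kappa> * zx t 0 = \<alpha> * u1 t 0 - \<gamma> * \<beta> * u2 t 0 \<and>
          \<alpha> * u1 t l2 - \<gamma> * \<beta> * u2 t l2 = - \<xi>1 * w1 t l2 \<and>
          - \<gamma> * \<beta> * u1 t l2 + \<beta> * u2 t l2 = - \<xi>2 * w2 t l2))"

(* norm of L^2(-l1,0) x L^2(0,l2)^4 *)
definition H_norm ::
  "real \<Rightarrow> real \<Rightarrow> (real \<Rightarrow> real) \<Rightarrow> (real \<Rightarrow> real) \<Rightarrow> (real \<Rightarrow> real) \<Rightarrow>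
   (real \<Rightarrow> real) \<Rightarrow> (real \<Rightarrow> real) \<Rightarrow> real" where
  "H_norm l1 l2 z u1 u2 w1 w2 =
     sqrt ((L2_norm (- l1) 0 z)\<^sup>2 + (L2_norm 0 l2 u1)\<^sup>2 + (L2_norm 0 l2 u2)\<^sup>2 +
           (L2_norm 0 l2 w1)\<^sup>2 + (L2_norm 0 l2 w2)\<^sup>2)"

(* In the second case the fields are limits, in C([0,T]; H) for every T > 0, of a sequence of
   classical solutions; they inherit continuity in H from the approximating sequence. *)
definition solution ::
  "real \<Rightarrow> real \<Rightarrow> real \<Rightarrow> real \<Rightarrow> real \<Rightarrow> real \<Rightarrow> real \<Rightarrow> real \<Rightarrow> real \<Rightarrow> real \<Rightarrow>
   (real \<Rightarrow> real \<Rightarrow> real) \<Rightarrow> (real \<Rightarrow> real \<Rightarrow> real) \<Rightarrow> (real \<Rightarrow> real \<Rightarrow> real) \<Rightarrow>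
   (real \<Rightarrow> real \<Rightarrow> real) \<Rightarrow> (real \<Rightarrow> real \<Rightarrow> real) \<Rightarrow> bool" where
  "solution l1 l2 \<kappa> \<rho> \<mu> \<alpha> \<beta> \<gamma> \<xi>1 \<xi>2 z u1 u2 w1 w2 \<longleftrightarrow>
     classical_solution l1 l2 \<kappa> \<rho> \<mu> \<alpha> \<beta> \<gamma> \<xi>1 \<xi>2 z u1 u2 w1 w2 \<or>
     ((\<forall>t\<ge>0. z t \<in> L2 (- l1) 0 \<and> u1 t \<in> L2 0 l2 \<and> u2 t \<in> L2 0 l2 \<and>
             w1 t \<in> L2 0 l2 \<and> w2 t \<in> L2 0 l2) \<and>
      (\<exists>Z U1 U2 W1 W2 :: nat \<Rightarrow> real \<Rightarrow> real \<Rightarrow> real.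
         (\<forall>n. classical_solution l1 l2 \<kappa> \<rho> \<mu> \<alpha> \<beta> \<gamma> \<xi>1 \<xi>2 (Z n) (U1 n) (U2 n) (W1 n) (W2 n)) \<and>
         (\<forall>T>0. uniform_limit {0..T}
            (\<lambda>n t. H_norm l1 l2 (\<lambda>x. Z n t x - z t x)
                     (\<lambda>x. U1 n t x - u1 t x) (\<lambda>x. U2 n t x - u2 t x)
                     (\<lambda>x. W1 n t x - w1 t x) (\<lambda>x. W2 n t x - w2 t x))
            (\<lambda>t. 0) sequentially)))"

definition energy ::
  "real \<Rightarrow> real \<Rightarrow> real \<Rightarrow> real \<Rightarrow> real \<Rightarrow> real \<Rightarrow> real \<Rightarrow>
   (real \<Rightarrow> real \<Rightarrow> real) \<Rightarrow> (real \<Rightarrow> real \<Rightarrow> real) \<Rightarrow> (real \<Rightarrow> real \<Rightarrow> real) \<Rightarrow>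
   (real \<Rightarrow> real \<Rightarrow> real) \<Rightarrow> (real \<Rightarrow> real \<Rightarrow> real) \<Rightarrow> real \<Rightarrow> real" where
  "energy l1 l2 \<rho> \<mu> \<alpha>1 \<beta> \<gamma> z u1 u2 w1 w2 t =
     1 / 2 * (LINT x|lebesgue_on {0..l1}. \<bar>z t (- x)\<bar>\<^sup>2) +
     1 / 2 * (LINT x|lebesgue_on {0..l2}.
        \<rho> * \<bar>w1 t x\<bar>\<^sup>2 + \<mu> * \<bar>w2 t x\<bar>\<^sup>2 + \<alpha>1 * \<bar>u1 t x\<bar>\<^sup>2 + \<beta> * \<bar>\<gamma> * u1 t x - u2 t x\<bar>\<^sup>2)"

end

theory Submission
  imports Defs
begin

text \<open>
  The idea is to perturb the energy by a multiplier term.  Along a classical solution the energy \<open>E\<close>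
  satisfies \<open>E' = - \<kappa> \<integral> zx\<^sup>2 - \<xi>1 w1(l2)\<^sup>2 - \<xi>2 w2(l2)\<^sup>2\<close>: the interface conditions make the power that
  leaves the beam enter the heat equation.  Here the heat part is damped in its whole domain, by
  Poincare's inequality, but the beam is damped only at its end \<open>l2\<close>.  Therefore consider
  \<open>V = E + \<epsilon> \<integral> x (\<rho> w1 u1 + \<mu> w2 u2)\<close> over \<open>(0, l2)\<close> with \<open>\<epsilon> = \<delta> a1\<close>.  If \<open>e\<close> denotes twice the energy
  density of the beam, the equations of motion give \<open>\<epsilon> l2 e(l2) / 2 - \<epsilon> / 2 \<integral> e\<close> as the time derivative
  of the added term (\<open>beam_identity\<close>).  The integral damps the beam in its whole domain.  The boundary term is
  quadratic in \<open>w1(l2)\<close> and \<open>w2(l2)\<close> because of the feedback law, and it is absorbed by the boundary damping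
  when \<open>\<delta>\<close> obeys its second and third bound (\<open>boundary_dissipation\<close>).  So \<open>V' \<le> - r E\<close> with
  \<open>r = 8 \<delta> b1 l2 \<kappa> / l1\<^sup>2\<close> (\<open>lyapunov_dissipation\<close>).

  By Young's inequality the added term is at most \<open>M \<delta> E\<close> (\<open>lyapunov_equivalent\<close>), and \<open>M \<delta> < 1\<close> by the first
  bound on \<open>\<delta>\<close>.  Hence \<open>V\<close> is comparable with \<open>E\<close>, and \<open>V' \<le> - r E \<le> - r (1 - M \<delta>) V\<close> because
  \<open>(1 - M \<delta>) (1 + M \<delta>) \<le> 1\<close>.  This is the stated rate, and the comparison of \<open>V\<close> with \<open>E\<close> at the times \<open>0\<close> and
  \<open>t\<close> gives the stated factor (\<open>classical_energy_decay\<close>).  The inequality passes to limits of classical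
  solutions, since the energy is continuous on the energy space (\<open>energy_tendsto\<close>).

  Two facts justify these computations for Sobolev functions: products of fields that are differentiable in
  time with values in \<open>L\<^sup>2\<close> may be differentiated under the integral (\<open>C1_L2_weighted_product_derivative\<close>), and
  an \<open>H\<^sup>1\<close> function is the indefinite integral of its weak derivative (\<open>H1_primitive_on\<close>), so that
  integration by parts applies up to the boundary (\<open>primitive_on_mult\<close>).
\<close>

section \<open>Square-integrable functions on an interval\<close>

lemma L2_mult_integrable:
  assumes "f \<in> L2 a b" "g \<in> L2 a b"
  shows "integrable (lebesgue_on {a..b}) (\<lambda>x. f x * g x)"
proof (rule Bochner_Integration.integrable_bound[of _ "\<lambda>x. (f x)\<^sup>2 + (g x)\<^sup>2"])
  have "\<bar>u * v\<bar> \<le> u\<^sup>2 + v\<^sup>2" for u v :: real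
  proof -
    have "2 * \<bar>u * v\<bar> \<le> u\<^sup>2 + v\<^sup>2" "0 \<le> \<bar>u * v\<bar>"
      using sum_squares_bound[of "\<bar>u\<bar>" "\<bar>v\<bar>"] by (simp_all add: abs_mult)
    then show ?thesis by linarith
  qed
  then show "AE x in lebesgue_on {a..b}. norm (f x * g x) \<le> norm ((f x)\<^sup>2 + (g x)\<^sup>2)"
    by simp
qed (use assms in \<open>auto simp: L2_def\<close>)

lemma L2_add:
  assumes "f \<in> L2 a b" "g \<in> L2 a b"
  shows "(\<lambda>x. f x + g x) \<in> L2 a b"
proof -
  have "integrable (lebesgue_on {a..b}) (\<lambda>x. (f x)\<^sup>2 + (g x)\<^sup>2 + 2 * (f x * g x))"
    using assms L2_mult_integrable[OF assms] by (auto simp: L2_def)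
  then show ?thesis
    using assms by (auto simp: L2_def power2_sum mult.assoc)
qed

lemma L2_bounded_mult:
  assumes k: "k \<in> borel_measurable (lebesgue_on {a..b})" "\<And>x. x \<in> {a..b} \<Longrightarrow> \<bar>k x\<bar> \<le> K"
    and f: "f \<in> L2 a b"
  shows "(\<lambda>x. k x * f x) \<in> L2 a b"
proof -
  have "integrable (lebesgue_on {a..b}) (\<lambda>x. (k x * f x)\<^sup>2)"
  proof (rule Bochner_Integration.integrable_bound[of _ "\<lambda>x. K\<^sup>2 * (f x)\<^sup>2"])
    have "norm ((k x * f x)\<^sup>2) \<le> norm (K\<^sup>2 * (f x)\<^sup>2)" if "x \<in> {a..b}" for x
      using power_mono[OF k(2)[OF that], of 2] by (auto simp: power_mult_distrib intro!: mult_right_mono)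
    then show "AE x in lebesgue_on {a..b}. norm ((k x * f x)\<^sup>2) \<le> norm (K\<^sup>2 * (f x)\<^sup>2)"
      by (intro AE_I2) auto
  qed (use f k in \<open>auto simp: L2_def\<close>)
  then show ?thesis
    using f k by (auto simp: L2_def)
qed

lemma L2_cmult: "f \<in> L2 a b \<Longrightarrow> (\<lambda>x. c * f x) \<in> L2 a b"
  by (rule L2_bounded_mult[of _ _ _ "\<bar>c\<bar>"]) auto

lemma L2_diff:
  assumes "f \<in> L2 a b" "g \<in> L2 a b"
  shows "(\<lambda>x. f x - g x) \<in> L2 a b"
  using L2_add[OF assms(1) L2_cmult[OF assms(2), of "-1"]] by simp

lemma L2_divide: "f \<in> L2 a b \<Longrightarrow> (\<lambda>x. f x / c) \<in> L2 a b"
  using L2_cmult[of f a b "1/c"] by simp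

lemma L2_integrable:
  assumes "f \<in> L2 a b"
  shows "integrable (lebesgue_on {a..b}) f"
proof -
  have "(\<lambda>_. 1) \<in> L2 a b"
    by (simp add: L2_def)
  then show ?thesis
    using L2_mult_integrable[OF assms, of "\<lambda>_. 1"] by simp
qed

lemma L2_Cauchy_Schwarz:
  assumes f: "f \<in> L2 a b" and g: "g \<in> L2 a b"
  shows "\<bar>LINT x|lebesgue_on {a..b}. f x * g x\<bar> \<le> L2_norm a b f * L2_norm a b g"
proof -
  define A where "A = (LINT x|lebesgue_on {a..b}. (f x)\<^sup>2)"
  define B where "B = (LINT x|lebesgue_on {a..b}. f x * g x)"
  define C where "C = (LINT x|lebesgue_on {a..b}. (g x)\<^sup>2)"
  have nonneg: "0 \<le> A" "0 \<le> C"
    by (auto simp: A_def C_def)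
  have quadratic: "0 \<le> A - 2 * r * B + r\<^sup>2 * C" for r
  proof -
    have "0 \<le> (LINT x|lebesgue_on {a..b}. (f x - r * g x)\<^sup>2)"
      by simp
    also have "\<dots> = (LINT x|lebesgue_on {a..b}. (f x)\<^sup>2 - 2 * r * (f x * g x) + r\<^sup>2 * (g x)\<^sup>2)"
      by (simp add: power2_eq_square algebra_simps)
    also have "\<dots> = A - 2 * r * B + r\<^sup>2 * C"
      using f g L2_mult_integrable[OF f g] by (simp add: A_def B_def C_def L2_def)
    finally show ?thesis .
  qed
  have "B\<^sup>2 \<le> A * C"
  proof (cases "C = 0")
    case True
    have "B = 0"
    proof (rule ccontr)
      assume "B \<noteq> 0"
      then show False
        using quadratic[of "(A + 1) / (2 * B)"] nonneg True by simp
    qed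
    then show ?thesis
      using nonneg by simp
  next
    case False
    then have "0 \<le> A - B\<^sup>2 / C"
      using quadratic[of "B / C"] by (simp add: power2_eq_square)
    then show ?thesis
      using False nonneg by (simp add: field_simps)
  qed
  then show ?thesis
    unfolding L2_norm_def A_def[symmetric] B_def[symmetric] C_def[symmetric]
    by (metis real_sqrt_abs real_sqrt_le_mono real_sqrt_mult)
qed

lemma L2_norm_nonneg: "0 \<le> L2_norm a b f"
  by (simp add: L2_norm_def)

lemma L2_norm_power2: "(L2_norm a b f)\<^sup>2 = (LINT x|lebesgue_on {a..b}. (f x)\<^sup>2)"
  by (simp add: L2_norm_def)

lemma L2_norm_triangle:
  assumes f: "f \<in> L2 a b" and g: "g \<in> L2 a b"
  shows "L2_norm a b (\<lambda>x. f x + g x) \<le> L2_norm a b f + L2_norm a b g"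
proof (rule power2_le_imp_le)
  have "(L2_norm a b (\<lambda>x. f x + g x))\<^sup>2
      = (LINT x|lebesgue_on {a..b}. (f x)\<^sup>2 + (g x)\<^sup>2 + 2 * (f x * g x))"
    by (simp add: L2_norm_power2 power2_sum mult.assoc)
  also have "\<dots> = (L2_norm a b f)\<^sup>2 + (L2_norm a b g)\<^sup>2 + 2 * (LINT x|lebesgue_on {a..b}. f x * g x)"
    using f g L2_mult_integrable[OF f g] by (simp add: L2_norm_power2 L2_def)
  also have "\<dots> \<le> (L2_norm a b f + L2_norm a b g)\<^sup>2"
    using L2_Cauchy_Schwarz[OF f g] by (simp add: power2_sum)
  finally show "(L2_norm a b (\<lambda>x. f x + g x))\<^sup>2 \<le> (L2_norm a b f + L2_norm a b g)\<^sup>2" .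
qed (simp add: L2_norm_nonneg)

lemma L2_norm_cmult: "L2_norm a b (\<lambda>x. c * f x) = \<bar>c\<bar> * L2_norm a b f"
  by (simp add: L2_norm_def power_mult_distrib real_sqrt_mult)

lemma L2_norm_minus_commute: "L2_norm a b (\<lambda>x. f x - g x) = L2_norm a b (\<lambda>x. g x - f x)"
  by (simp add: L2_norm_def power2_commute)

lemma L2_norm_diff_le:
  assumes "f \<in> L2 a b" "g \<in> L2 a b"
  shows "\<bar>L2_norm a b f - L2_norm a b g\<bar> \<le> L2_norm a b (\<lambda>x. f x - g x)"
  using L2_norm_triangle[OF L2_diff[OF assms] assms(2)]
    L2_norm_triangle[OF L2_diff[OF assms(2,1)] assms(1)]
  by (simp add: L2_norm_minus_commute[of a b g f])

lemma weighted_product_bound: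
  assumes k: "k \<in> borel_measurable (lebesgue_on {a..b})" "\<And>x. x \<in> {a..b} \<Longrightarrow> \<bar>k x\<bar> \<le> K" and "0 \<le> K"
    and f: "f \<in> L2 a b" and g: "g \<in> L2 a b"
  shows "\<bar>LINT x|lebesgue_on {a..b}. k x * f x * g x\<bar> \<le> K * (L2_norm a b f * L2_norm a b g)"
proof -
  have kf: "(\<lambda>x. k x * f x) \<in> L2 a b"
    by (rule L2_bounded_mult[OF k f])
  have "L2_norm a b (\<lambda>x. k x * f x) \<le> L2_norm a b (\<lambda>x. K * f x)"
    unfolding L2_norm_def
  proof (intro real_sqrt_le_mono integral_mono)
    fix x assume "x \<in> space (lebesgue_on {a..b})"
    then show "(k x * f x)\<^sup>2 \<le> (K * f x)\<^sup>2"
      using power_mono[OF k(2), of x 2] by (auto simp: power_mult_distrib intro!: mult_right_mono)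
  qed (use kf L2_cmult[OF f, of K] in \<open>auto simp: L2_def\<close>)
  then have "L2_norm a b (\<lambda>x. k x * f x) \<le> K * L2_norm a b f"
    using \<open>0 \<le> K\<close> by (simp add: L2_norm_cmult)
  then show ?thesis
    using L2_Cauchy_Schwarz[OF kf g] mult_right_mono[OF _ L2_norm_nonneg[of a b g]]
    by (fastforce simp: mult.assoc)
qed

section \<open>Time derivatives of weighted inner products\<close>

text \<open>
  Write \<open>D f s\<close> for the difference quotient of \<open>f\<close> between \<open>t\<close> and \<open>s\<close>, and \<open>W\<close> for the weighted
  inner product.  The difference quotient of \<open>W (f s) (g s)\<close> exceeds its expected limit by
  \<open>W (D f - ft) g + W f (D g - gt) + W (D f - ft) (g s - g t) + W ft (g s - g t)\<close>,
  and by Cauchy-Schwarz each of the four terms tends to zero.  The constant weight yields the energy,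
  the weight \<open>x\<close> the cross term that is added to it.
\<close>
lemma C1_L2_weighted_product_derivative:
  fixes k :: "real \<Rightarrow> real"
  assumes k: "k \<in> borel_measurable (lebesgue_on {a..b})" "\<And>x. x \<in> {a..b} \<Longrightarrow> \<bar>k x\<bar> \<le> K"
    and f: "C1_L2 a b f ft" "C0_L2 a b f" and g: "C1_L2 a b g gt" "C0_L2 a b g" and "0 \<le> t"
  shows "((\<lambda>s. LINT x|lebesgue_on {a..b}. k x * f s x * g s x) has_real_derivative
          (LINT x|lebesgue_on {a..b}. k x * ft t x * g t x + k x * f t x * gt t x)) (at t within {0..})"
proof -
  define W where "W = (\<lambda>p q. LINT x|lebesgue_on {a..b}. k x * p x * q x)"
  define D where "D = (\<lambda>h :: real \<Rightarrow> real \<Rightarrow> real. \<lambda>s x. (h s x - h t x) / (s - t))"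
  define K' where "K' = max K 0"
  note k' = k(1) order_trans[OF k(2) max.cobounded1[of K 0], folded K'_def]
  have in_L2: "f s \<in> L2 a b" "g s \<in> L2 a b" "ft s \<in> L2 a b" "gt s \<in> L2 a b" if "0 \<le> s" for s
    using that f g by (auto simp: C1_L2_def C0_L2_def)
  have W_integrable: "integrable (lebesgue_on {a..b}) (\<lambda>x. k x * p x * q x)"
    if "p \<in> L2 a b" "q \<in> L2 a b" for p q
    by (rule L2_mult_integrable[OF L2_bounded_mult[OF k that(1)] that(2)])
  have W_bound: "\<bar>W p q\<bar> \<le> K' * (L2_norm a b p * L2_norm a b q)" if "p \<in> L2 a b" "q \<in> L2 a b" for p q
    unfolding W_def by (rule weighted_product_bound[OF k' _ that]) (auto simp: K'_def)
  have D_in_L2: "D f s \<in> L2 a b" "D g s \<in> L2 a b" if "0 \<le> s" for s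
    unfolding D_def using that \<open>0 \<le> t\<close> by (auto intro!: L2_divide L2_diff in_L2)
  have Df: "((\<lambda>s. L2_norm a b (\<lambda>x. D f s x - ft t x)) \<longlongrightarrow> 0) (at t within {0..})"
    and Dg: "((\<lambda>s. L2_norm a b (\<lambda>x. D g s x - gt t x)) \<longlongrightarrow> 0) (at t within {0..})"
    and cg: "((\<lambda>s. L2_norm a b (\<lambda>x. g s x - g t x)) \<longlongrightarrow> 0) (at t within {0..})"
    using f g \<open>0 \<le> t\<close> by (auto simp: C1_L2_def C0_L2_def D_def)
  have eventually_ok: "\<forall>\<^sub>F s in at t within {0..}. 0 \<le> s \<and> s \<noteq> t"
    by (auto simp: eventually_at_filter)
  have vanish: "((\<lambda>s. W (p s) (q s)) \<longlongrightarrow> 0) (at t within {0..})"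
    if "((\<lambda>s. L2_norm a b (p s) * L2_norm a b (q s)) \<longlongrightarrow> 0) (at t within {0..})"
      "\<And>s. 0 \<le> s \<Longrightarrow> p s \<in> L2 a b \<and> q s \<in> L2 a b" for p q
  proof (rule Lim_null_comparison)
    show "\<forall>\<^sub>F s in at t within {0..}. norm (W (p s) (q s)) \<le> K' * (L2_norm a b (p s) * L2_norm a b (q s))"
      using eventually_ok by eventually_elim (use that(2) W_bound in auto)
    show "((\<lambda>s. K' * (L2_norm a b (p s) * L2_norm a b (q s))) \<longlongrightarrow> 0) (at t within {0..})"
      using tendsto_mult_left[OF that(1), of K'] by simp
  qed
  have "((\<lambda>s. W (\<lambda>x. D f s x - ft t x) (g t) + W (f t) (\<lambda>x. D g s x - gt t x)
        + W (\<lambda>x. D f s x - ft t x) (\<lambda>x. g s x - g t x) + W (ft t) (\<lambda>x. g s x - g t x)) \<longlongrightarrow> 0 + 0 + 0 + 0)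
        (at t within {0..})"
    using tendsto_mult[OF Df tendsto_const[of "L2_norm a b (g t)"]]
      tendsto_mult[OF tendsto_const[of "L2_norm a b (f t)"] Dg]
      tendsto_mult[OF Df cg] tendsto_mult[OF tendsto_const[of "L2_norm a b (ft t)"] cg] \<open>0 \<le> t\<close>
    by (intro tendsto_add vanish) (auto intro!: L2_diff D_in_L2 in_L2)
  moreover have "\<forall>\<^sub>F s in at t within {0..}.
      W (\<lambda>x. D f s x - ft t x) (g t) + W (f t) (\<lambda>x. D g s x - gt t x)
        + W (\<lambda>x. D f s x - ft t x) (\<lambda>x. g s x - g t x) + W (ft t) (\<lambda>x. g s x - g t x)
      = (W (f s) (g s) - W (f t) (g t)) / (s - t) - (W (ft t) (g t) + W (f t) (gt t))"
    using eventually_ok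
  proof eventually_elim
    case (elim s)
    then have L: "f s \<in> L2 a b" "g s \<in> L2 a b" "f t \<in> L2 a b" "g t \<in> L2 a b" "ft t \<in> L2 a b" "gt t \<in> L2 a b"
      "D f s \<in> L2 a b" "D g s \<in> L2 a b"
      using in_L2 D_in_L2 \<open>0 \<le> t\<close> by auto
    have W_diff1: "W (\<lambda>x. p x - q x) r = W p r - W q r" and W_diff2: "W r (\<lambda>x. p x - q x) = W r p - W r q"
      if "p \<in> L2 a b" "q \<in> L2 a b" "r \<in> L2 a b" for p q r
      using W_integrable that by (simp_all add: W_def left_diff_distrib right_diff_distrib)
    have D1: "W (D f s) q = (W (f s) q - W (f t) q) / (s - t)" if "q \<in> L2 a b" for q
    proof -
      have "W (D f s) q = W (\<lambda>x. f s x - f t x) q / (s - t)"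
        by (simp add: W_def D_def)
      then show ?thesis
        using that L by (simp add: W_diff1)
    qed
    have D2: "W q (D g s) = (W q (g s) - W q (g t)) / (s - t)" if "q \<in> L2 a b" for q
    proof -
      have "W q (D g s) = W q (\<lambda>x. g s x - g t x) / (s - t)"
        by (simp add: W_def D_def)
      then show ?thesis
        using that L by (simp add: W_diff2)
    qed
    show ?case
      using L elim by (simp add: W_diff1 W_diff2 L2_diff D1 D2 diff_divide_distrib)
  qed
  ultimately have "((\<lambda>s. (W (f s) (g s) - W (f t) (g t)) / (s - t) - (W (ft t) (g t) + W (f t) (gt t))) \<longlongrightarrow> 0)
      (at t within {0..})"
    by (simp add: tendsto_cong)
  then have "((\<lambda>s. W (f s) (g s)) has_real_derivative (W (ft t) (g t) + W (f t) (gt t))) (at t within {0..})"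
    unfolding has_field_derivative_iff by (simp add: LIM_zero_iff)
  moreover have "W (ft t) (g t) + W (f t) (gt t)
      = (LINT x|lebesgue_on {a..b}. k x * ft t x * g t x + k x * f t x * gt t x)"
    using W_integrable in_L2[OF \<open>0 \<le> t\<close>] by (simp add: W_def)
  ultimately show ?thesis
    by (simp add: W_def)
qed

section \<open>Indefinite integrals and integration by parts\<close>

text \<open>
  By Lebesgue's theorem this says that \<open>f\<close> is absolutely continuous on the interval with derivative
  \<open>f'\<close> almost everywhere.  The integral form suffices for the calculus below and avoids pointwise
  differentiation.
\<close>
definition primitive_on :: "real \<Rightarrow> real \<Rightarrow> (real \<Rightarrow> real) \<Rightarrow> (real \<Rightarrow> real) \<Rightarrow> bool" where
  "primitive_on a b f f' \<longleftrightarrow> integrable (lebesgue_on {a..b}) f' \<and>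
     (\<forall>x\<in>{a..b}. (LINT s|lebesgue_on {a..x}. f' s) = f x - f a)"

lemma primitive_on_end:
  assumes "primitive_on a b f f'" "a \<le> b"
  shows "(LINT s|lebesgue_on {a..b}. f' s) = f b - f a"
  using assms by (auto simp: primitive_on_def)

lemma primitive_on_restrict:
  assumes "primitive_on a b f f'" "c \<le> b"
  shows "primitive_on a c f f'"
  using assms integrable_subinterval[of a b f' a c] by (auto simp: primitive_on_def)

lemma primitive_onI:
  assumes "integrable (lebesgue_on {a..b}) f'"
    and "\<And>x. a \<le> x \<Longrightarrow> x \<le> b \<Longrightarrow> (LINT s|lebesgue_on {a..x}. f' s) = f x - f a"
  shows "primitive_on a b f f'"
  using assms by (auto simp: primitive_on_def)

lemma primitive_on_continuous:
  assumes "primitive_on a b f f'"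
  shows "continuous_on {a..b} f"
proof -
  have "continuous_on {a..b} (\<lambda>x. f a + (LINT s|lebesgue_on {a..x}. f' s))"
    using assms by (intro continuous_intros indefinite_integral_continuous_real) (simp add: primitive_on_def)
  then show ?thesis
    by (rule continuous_on_eq) (use assms in \<open>auto simp: primitive_on_def\<close>)
qed

lemma primitive_on_ident: "primitive_on a b (\<lambda>x. x) (\<lambda>_. 1)"
  by (rule primitive_onI) (auto simp: measure_restrict_space)

lemma primitive_on_add:
  assumes "primitive_on a b f f'" "primitive_on a b g g'"
  shows "primitive_on a b (\<lambda>x. f x + g x) (\<lambda>x. f' x + g' x)"
proof (rule primitive_onI)
  show "integrable (lebesgue_on {a..b}) (\<lambda>x. f' x + g' x)"
    using assms by (simp add: primitive_on_def)
  fix x assume "a \<le> x" "x \<le> b"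
  then have "primitive_on a x f f'" "primitive_on a x g g'"
    using assms primitive_on_restrict by blast+
  then show "(LINT s|lebesgue_on {a..x}. f' s + g' s) = f x + g x - (f a + g a)"
    using \<open>a \<le> x\<close> by (simp add: primitive_on_def)
qed

lemma primitive_on_cmult:
  assumes "primitive_on a b f f'"
  shows "primitive_on a b (\<lambda>x. c * f x) (\<lambda>x. c * f' x)"
  using assms by (auto simp: primitive_on_def right_diff_distrib)

lemma integral_upto_eq_indicator:
  fixes f' :: "real \<Rightarrow> real"
  assumes "x \<le> b"
  shows "(LINT s|lebesgue_on {a..x}. f' s) = (LINT s|lebesgue_on {a..b}. indicator {..x} s * f' s)"
proof -
  have measurable: "{c..d} \<inter> space lebesgue \<in> sets lebesgue" for c d :: real
    by simp
  have "(\<lambda>s. indicator {a..x} s *\<^sub>R f' s) = (\<lambda>s. indicator {a..b} s *\<^sub>R (indicator {..x} s * f' s))"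
    using assms by (auto simp: indicator_def)
  then show ?thesis
    by (simp only: integral_restrict_space[OF measurable])
qed

text \<open>
  Fubini's theorem on the triangle \<open>x \<le> s\<close>.
\<close>
lemma integral_product_triangle_swap:
  fixes p q :: "real \<Rightarrow> real"
  assumes p: "integrable (lebesgue_on {a..b}) p" and q: "integrable (lebesgue_on {a..b}) q"
  shows "integrable (lebesgue_on {a..b}) (\<lambda>s. q s * (LINT x|lebesgue_on {a..b}. indicator {..s} x * p x))"
    and "(LINT s|lebesgue_on {a..b}. q s * (LINT x|lebesgue_on {a..b}. indicator {..s} x * p x))
       = (LINT x|lebesgue_on {a..b}. p x * (LINT s|lebesgue_on {a..b}. indicator {x..} s * q s))"
proof -
  let ?M = "lebesgue_on {a..b}"
  interpret finite_measure ?M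
    by (rule finite_measure_lebesgue_on) simp
  interpret P: pair_sigma_finite ?M ?M ..
  have [measurable]: "p \<in> borel_measurable ?M" "q \<in> borel_measurable ?M"
    using p q by auto
  have [measurable]: "(\<lambda>x. x) \<in> borel_measurable ?M"
    by (rule continuous_imp_measurable_on_sets_lebesgue) (auto intro: continuous_intros)
  define h where "h = (\<lambda>z :: real \<times> real. if snd z \<le> fst z then q (fst z) * p (snd z) else 0)"
  have "integrable (?M \<Otimes>\<^sub>M ?M) (\<lambda>z. q (fst z) * p (snd z))"
    by (rule P.Fubini_integrable) (use p q in \<open>auto simp: abs_mult\<close>)
  then have h: "integrable (?M \<Otimes>\<^sub>M ?M) h"
  proof (rule Bochner_Integration.integrable_bound)
    show "h \<in> borel_measurable (?M \<Otimes>\<^sub>M ?M)"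
      unfolding h_def by measurable
  qed (simp add: h_def)
  have row: "(LINT x|?M. h (s, x)) = q s * (LINT x|?M. indicator {..s} x * p x)" for s
  proof -
    have "(\<lambda>x. h (s, x)) = (\<lambda>x. q s * (indicator {..s} x * p x))"
      by (auto simp: h_def)
    then show ?thesis by simp
  qed
  have column: "(LINT s|?M. h (s, x)) = p x * (LINT s|?M. indicator {x..} s * q s)" for x
  proof -
    have "(\<lambda>s. h (s, x)) = (\<lambda>s. p x * (indicator {x..} s * q s))"
      by (auto simp: h_def)
    then show ?thesis by simp
  qed
  show "integrable ?M (\<lambda>s. q s * (LINT x|?M. indicator {..s} x * p x))"
    using P.integrable_fst'[OF h] by (simp add: row)
  show "(LINT s|?M. q s * (LINT x|?M. indicator {..s} x * p x))
       = (LINT x|?M. p x * (LINT s|?M. indicator {x..} s * q s))"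
    using P.Fubini_integral[of "\<lambda>s x. h (s, x)"] h by (simp add: row column)
qed

text \<open>
  The two half-lines overlap only in the null set \<open>{x}\<close>.
\<close>
lemma integral_split_indicator:
  fixes p :: "real \<Rightarrow> real"
  assumes p: "integrable (lebesgue_on {a..b}) p"
  shows "(LINT s|lebesgue_on {a..b}. indicator {x..} s * p s)
       = (LINT s|lebesgue_on {a..b}. p s) - (LINT s|lebesgue_on {a..b}. indicator {..x} s * p s)"
proof -
  let ?M = "lebesgue_on {a..b}"
  have int: "integrable ?M (\<lambda>s. indicator A s * p s)" if "A \<in> sets borel" for A
  proof -
    have "A \<inter> {a..b} \<in> sets ?M"
      using that by (auto simp: sets_restrict_space)
    then have "integrable ?M (\<lambda>s. indicator (A \<inter> {a..b}) s *\<^sub>R p s)"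
      by (rule integrable_mult_indicator[OF _ p])
    also have "?this \<longleftrightarrow> ?thesis"
      by (rule Bochner_Integration.integrable_cong) (auto simp: indicator_def)
    finally show ?thesis .
  qed
  have "AE s in lebesgue. s \<noteq> x"
    by (rule AE_I'[of "{x}"]) auto
  then have "AE s in ?M. indicator {x..} s * p s + indicator {..x} s * p s = p s"
    by (auto simp: AE_restrict_space_iff indicator_def elim: eventually_mono)
  then have "(LINT s|?M. indicator {x..} s * p s + indicator {..x} s * p s) = (LINT s|?M. p s)"
    by (intro integral_cong_AE) (use int p in \<open>auto\<close>)
  then show ?thesis
    using int by simp
qed

text \<open>
  Inserting \<open>f x = f a + \<integral>\<^sub>a\<^sup>x f'\<close> into \<open>\<integral> f g'\<close> and exchanging the order of integration gives
  \<open>f a (g b - g a) + \<integral> f' (g b - g)\<close>; the terms \<open>\<integral> f' g\<close> then cancel in the sum.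
\<close>
lemma primitive_on_mult:
  assumes f: "primitive_on a b f f'" and g: "primitive_on a b g g'"
  shows "primitive_on a b (\<lambda>x. f x * g x) (\<lambda>x. f' x * g x + f x * g' x)"
proof (rule primitive_onI)
  have mixed: "integrable (lebesgue_on {a..b}) (\<lambda>x. h' x * k x)"
    if h: "primitive_on a b h h'" and k: "primitive_on a b k k'" for h h' k k'
  proof -
    have h': "integrable (lebesgue_on {a..b}) h'" and k': "integrable (lebesgue_on {a..b}) k'"
      using h k by (auto simp: primitive_on_def)
    have "(LINT s|lebesgue_on {a..b}. indicator {..x} s * k' s) = k x - k a" if "x \<in> {a..b}" for x
      using k that by (simp add: primitive_on_def flip: integral_upto_eq_indicator)
    then have "?thesis \<longleftrightarrow> integrable (lebesgue_on {a..b})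
        (\<lambda>x. k a * h' x + h' x * (LINT s|lebesgue_on {a..b}. indicator {..x} s * k' s))"
      by (intro Bochner_Integration.integrable_cong) (auto simp: right_diff_distrib)
    then show ?thesis
      using Bochner_Integration.integrable_add[OF
          integrable_mult_right[OF h', of "k a"] integral_product_triangle_swap(1)[OF k' h']] by blast
  qed
  show int: "integrable (lebesgue_on {a..b}) (\<lambda>x. f' x * g x + f x * g' x)"
    using mixed[OF f g] mixed[OF g f] by (simp add: mult.commute)
  have ends: "(LINT x|lebesgue_on {a..c}. f' x * g x + f x * g' x) = f c * g c - f a * g a"
    if f: "primitive_on a c f f'" and g: "primitive_on a c g g'" and "a \<le> c"
      and fg: "integrable (lebesgue_on {a..c}) (\<lambda>x. f' x * g x)"
      and gf: "integrable (lebesgue_on {a..c}) (\<lambda>x. f x * g' x)" for c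
  proof -
    let ?M = "lebesgue_on {a..c}"
    have f': "integrable ?M f'" and g': "integrable ?M g'"
      using f g by (auto simp: primitive_on_def)
    have val: "(LINT s|?M. indicator {..x} s * f' s) = f x - f a"
      "(LINT s|?M. indicator {..x} s * g' s) = g x - g a" if "x \<in> {a..c}" for x
      using f g that by (simp_all add: primitive_on_def flip: integral_upto_eq_indicator)
    have "(LINT x|?M. f x * g' x)
        = (LINT x|?M. f a * g' x + g' x * (LINT s|?M. indicator {..x} s * f' s))"
      by (rule Bochner_Integration.integral_cong) (simp_all add: val, simp add: algebra_simps)
    also have "\<dots> = f a * (g c - g a) + (LINT x|?M. f' x * (LINT s|?M. indicator {x..} s * g' s))"
      using integral_product_triangle_swap[OF f' g'] g' primitive_on_end[OF g \<open>a \<le> c\<close>] by simp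
    also have "(LINT x|?M. f' x * (LINT s|?M. indicator {x..} s * g' s)) = (LINT x|?M. g c * f' x - f' x * g x)"
      using integral_split_indicator[OF g'] primitive_on_end[OF g \<open>a \<le> c\<close>]
      by (intro Bochner_Integration.integral_cong) (simp_all add: val, simp add: algebra_simps)
    also have "\<dots> = g c * (f c - f a) - (LINT x|?M. f' x * g x)"
      using f' fg primitive_on_end[OF f \<open>a \<le> c\<close>] by simp
    finally show ?thesis
      using fg gf by (simp add: algebra_simps)
  qed
  fix x assume x: "a \<le> x" "x \<le> b"
  show "(LINT s|lebesgue_on {a..x}. f' s * g s + f s * g' s) = f x * g x - f a * g a"
  proof (rule ends)
    show "primitive_on a x f f'" "primitive_on a x g g'"
      using f g x primitive_on_restrict by blast+
    show "integrable (lebesgue_on {a..x}) (\<lambda>x. f' x * g x)" "integrable (lebesgue_on {a..x}) (\<lambda>x. f x * g' x)"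
      using integrable_subinterval[OF mixed[OF f g], of a x] integrable_subinterval[OF mixed[OF g f], of a x] x
      by (auto simp: mult.commute)
  qed fact
qed

section \<open>Weak derivatives\<close>

text \<open>
  The square of the positive part is continuously differentiable, and a second difference of it grows
  from \<open>0\<close> at \<open>s = 0\<close> to the constant \<open>1\<close> from \<open>s = 1\<close> on: a \<open>C\<^sup>1\<close> smoothing of the Heaviside function.
  Its derivative is \<open>tent\<close>.
\<close>
definition ramp :: "real \<Rightarrow> real" where
  "ramp s = 2 * ((max 0 s)\<^sup>2 - 2 * (max 0 (s - 1/2))\<^sup>2 + (max 0 (s - 1))\<^sup>2)"

definition tent :: "real \<Rightarrow> real" where
  "tent s = 4 * (max 0 s - 2 * max 0 (s - 1/2) + max 0 (s - 1))"

lemma squared_pos_part_derivative: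
  "((\<lambda>s::real. (max 0 s)\<^sup>2) has_real_derivative 2 * max 0 s) (at s)"
proof (cases s "0 :: real" rule: linorder_cases)
  case less
  have "((\<lambda>_. 0) has_real_derivative 2 * max 0 s) (at s)"
    using less by simp
  then show ?thesis
    by (rule has_field_derivative_transform_within_open[of _ _ _ "{..<0}"]) (use less in auto)
next
  case equal
  have "((\<lambda>h :: real. (max 0 h)\<^sup>2 / h) \<longlongrightarrow> 0) (at 0)"
  proof (rule Lim_null_comparison)
    show "\<forall>\<^sub>F h in at (0::real). norm ((max 0 h)\<^sup>2 / h) \<le> \<bar>h\<bar>"
      by (rule always_eventually) (auto simp: max_def power2_eq_square)
    show "((\<lambda>h :: real. \<bar>h\<bar>) \<longlongrightarrow> 0) (at 0)"
      by (rule tendsto_rabs_zero) (rule tendsto_ident_at)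
  qed
  then show ?thesis
    using equal by (simp add: DERIV_def)
next
  case greater
  have "((\<lambda>s. s\<^sup>2) has_real_derivative 2 * max 0 s) (at s)"
    using greater by (auto intro!: derivative_eq_intros)
  then show ?thesis
    by (rule has_field_derivative_transform_within_open[of _ _ _ "{0<..}"]) (use greater in auto)
qed

lemma ramp_derivative: "(ramp has_real_derivative tent s) (at s)"
proof -
  have shifted: "((\<lambda>s. (max 0 (s - c))\<^sup>2) has_real_derivative 2 * max 0 (s - c)) (at s)" for c
  proof -
    have "((\<lambda>s. s - c) has_real_derivative 1) (at s)"
      by (auto intro!: derivative_eq_intros)
    from DERIV_chain2[where f = "\<lambda>s. (max 0 s)\<^sup>2", OF squared_pos_part_derivative this] show ?thesis
      by simp
  qed
  from DERIV_cmult[OF DERIV_add[OF DERIV_diff[OF shifted[of 0] DERIV_cmult[OF shifted[of "1/2"], of 2]]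
      shifted[of 1]], of 2]
  show ?thesis
    unfolding ramp_def[abs_def] tent_def by (simp add: algebra_simps)
qed

lemma scaled_ramp_derivative:
  "((\<lambda>s. ramp (r * (s - c))) has_real_derivative r * tent (r * (s - c))) (at s)"
proof -
  have "((\<lambda>s. r * (s - c)) has_real_derivative r) (at s)"
    by (auto intro!: derivative_eq_intros)
  from DERIV_chain2[OF ramp_derivative this] show ?thesis
    by (simp add: mult.commute)
qed

lemma tent_continuous: "continuous_on A tent"
  unfolding tent_def[abs_def] by (intro continuous_intros)

lemma tent_nonneg: "0 \<le> tent s"
  by (simp add: tent_def max_def)

lemma tent_outside: "s \<notin> {0..1} \<Longrightarrow> tent s = 0"
  by (auto simp: tent_def max_def)

lemma ramp_left: "s \<le> 0 \<Longrightarrow> ramp s = 0"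
  by (simp add: ramp_def max_def)

lemma ramp_right: "1 \<le> s \<Longrightarrow> ramp s = 1"
  by (auto simp: ramp_def max_def power2_eq_square algebra_simps)

lemma ramp_mono: "s \<le> t \<Longrightarrow> ramp s \<le> ramp t"
  using ramp_derivative tent_nonneg by (metis DERIV_nonneg_imp_nondecreasing)

lemma ramp_bounds: "0 \<le> ramp s" "ramp s \<le> 1"
  using ramp_mono[of "min s 0" s] ramp_mono[of s "max s 1"] ramp_left[of "min s 0"] ramp_right[of "max s 1"]
  by auto

text \<open>
  The rescaled tents are nonnegative, have integral one and are supported in \<open>[x, x + 1 / n]\<close>.
\<close>
lemma tent_approximate_identity:
  fixes f :: "real \<Rightarrow> real"
  assumes f: "continuous_on {a..b} f" and x: "a < x" "x < b"
  shows "(\<lambda>n. LINT s|lebesgue_on {a..b}. f s * (real n * tent (real n * (s - x)))) \<longlonglongrightarrow> f x"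
proof (rule LIMSEQ_I)
  fix \<epsilon> :: real assume "0 < \<epsilon>"
  then obtain d where d: "0 < d" "\<And>s. s \<in> {a..b} \<Longrightarrow> \<bar>s - x\<bar> < d \<Longrightarrow> \<bar>f s - f x\<bar> < \<epsilon> / 2"
    using f x unfolding continuous_on_iff dist_real_def
    by (metis atLeastAtMost_iff half_gt_zero less_eq_real_def)
  obtain N where N: "1 / min d (b - x) < real N"
    using reals_Archimedean2 by blast
  have "norm ((LINT s|lebesgue_on {a..b}. f s * (real n * tent (real n * (s - x)))) - f x) < \<epsilon>" if "N \<le> n" for n
  proof -
    let ?M = "lebesgue_on {a..b}"
    define k where "k = (\<lambda>s. real n * tent (real n * (s - x)))"
    have n: "1 < real n * d" "1 < real n * (b - x)" "0 < real n"
    proof -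
      have "1 / min d (b - x) < real n"
        using N that by (meson less_le_trans of_nat_mono)
      then have n: "1 < real n * min d (b - x)"
        using d x by (simp add: field_simps)
      have "real n * min d (b - x) \<le> real n * d" "real n * min d (b - x) \<le> real n * (b - x)"
        by (auto intro!: mult_left_mono)
      then show "1 < real n * d" "1 < real n * (b - x)"
        using n by linarith+
      then show "0 < real n"
        by (cases n) auto
    qed
    have k_cont: "continuous_on {a..b} k"
      unfolding k_def by (intro continuous_intros continuous_on_compose2[OF tent_continuous[of UNIV]]) auto
    have k_nonneg: "0 \<le> k s" for s
      by (simp add: k_def tent_nonneg)
    have int_k: "integrable ?M k"
      by (rule continuous_imp_integrable_real[OF k_cont])
    have "(k has_integral ramp (real n * (b - x)) - ramp (real n * (a - x))) {a..b}"
    proof (rule fundamental_theorem_of_calculus)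
      fix s assume "s \<in> {a..b}"
      have "((\<lambda>s. ramp (real n * (s - x))) has_real_derivative k s) (at s)"
        unfolding k_def by (rule scaled_ramp_derivative)
      then show "((\<lambda>s. ramp (real n * (s - x))) has_vector_derivative k s) (at s within {a..b})"
        by (simp add: has_real_derivative_iff_has_vector_derivative has_vector_derivative_at_within)
    qed (use x in simp)
    moreover have "ramp (real n * (b - x)) = 1" "ramp (real n * (a - x)) = 0"
      using n x by (auto intro!: ramp_left ramp_right simp: mult_le_0_iff)
    ultimately have k_one: "(LINT s|?M. k s) = 1"
      by (simp add: lebesgue_integral_eq_integral[OF int_k] integral_unique)
    have int_fk: "integrable ?M (\<lambda>s. (f s - f x) * k s)"
      by (intro continuous_imp_integrable_real continuous_intros f k_cont)
    have int_f: "integrable ?M (\<lambda>s. f s * k s)"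
      by (intro continuous_imp_integrable_real continuous_intros f k_cont)
    have close: "norm ((f s - f x) * k s) \<le> \<epsilon> / 2 * k s" if "s \<in> {a..b}" for s
    proof (cases "\<bar>s - x\<bar> < d")
      case True
      then show ?thesis
        using mult_right_mono[OF less_imp_le[OF d(2)[OF that True]] k_nonneg[of s]] k_nonneg[of s]
        by (simp add: abs_mult)
    next
      case False
      then have "real n * (s - x) \<notin> {0..1}"
      proof (cases "s < x")
        case True
        then show ?thesis
          using n by (simp add: zero_le_mult_iff)
      next
        case False
        then have "real n * d \<le> real n * (s - x)"
          using \<open>\<not> \<bar>s - x\<bar> < d\<close> by (intro mult_left_mono) auto
        then have "1 < real n * (s - x)"
          using n by linarith
        then show ?thesis
          by auto
      qed
      then show ?thesis
        by (simp add: k_def tent_outside)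
    qed
    have "(LINT s|?M. f s * k s) - f x = (LINT s|?M. (f s - f x) * k s)"
      using int_f int_k k_one by (simp add: left_diff_distrib)
    also have "norm \<dots> \<le> (LINT s|?M. \<epsilon> / 2 * k s)"
      by (rule Bochner_Integration.integral_norm_bound_integral) (use int_fk int_k close in auto)
    also have "\<dots> = \<epsilon> / 2"
      using k_one by simp
    finally show ?thesis
      using \<open>0 < \<epsilon>\<close> unfolding k_def by linarith
  qed
  then show "\<exists>no. \<forall>n\<ge>no. norm ((LINT s|lebesgue_on {a..b}. f s * (real n * tent (real n * (s - x)))) - f x) < \<epsilon>"
    by blast
qed

lemma ramp_tendsto_indicator:
  "(\<lambda>n. ramp (real n * (s - x))) \<longlonglongrightarrow> indicator {x<..} s"
proof (cases "x < s")
  case True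
  obtain N where N: "1 / (s - x) < real N"
    using reals_Archimedean2 by blast
  have "ramp (real n * (s - x)) = 1" if "N \<le> n" for n
  proof -
    have "1 / (s - x) < real n"
      using N that by (meson less_le_trans of_nat_mono)
    then show ?thesis
      using True by (intro ramp_right) (simp add: field_simps)
  qed
  then show ?thesis
    using True by (auto intro!: tendsto_eventually eventually_sequentiallyI[of N])
next
  case False
  then have "ramp (real n * (s - x)) = 0" for n
    by (intro ramp_left) (simp add: mult_le_0_iff)
  then show ?thesis
    using False by simp
qed

text \<open>
  The test function is a smoothed indicator of \<open>(x, y]\<close>, rising just to the right of \<open>x\<close> and falling
  just to the right of \<open>y\<close>.  Its derivative tends to the difference of the Dirac masses at \<open>x\<close> and
  \<open>y\<close>, while dominated convergence applies to the side with \<open>f'\<close>.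
\<close>
lemma weak_deriv_increment:
  assumes "weak_deriv a b f f'" and f: "continuous_on {a..b} f" and f': "integrable (lebesgue_on {a..b}) f'"
    and xy: "a < x" "x \<le> y" "y < b"
  shows "f y - f x = (LINT s|lebesgue_on {a..y}. f' s) - (LINT s|lebesgue_on {a..x}. f' s)"
proof -
  let ?M = "lebesgue_on {a..b}"
  define \<phi> where "\<phi> = (\<lambda>n s. ramp (real n * (s - x)) - ramp (real n * (s - y)))"
  define \<phi>' where "\<phi>' = (\<lambda>n s. real n * tent (real n * (s - x)) - real n * tent (real n * (s - y)))"
  obtain N where N: "1 / (b - y) < real N"
    using reals_Archimedean2 by blast
  have test: "test_fun a b (\<phi> n) (\<phi>' n)" if "N \<le> n" for n
    unfolding test_fun_def
  proof (intro conjI allI)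
    have "1 / (b - y) < real n"
      using N that by (meson less_le_trans of_nat_mono)
    moreover have "0 < 1 / (b - y)"
      using xy by simp
    ultimately have n: "0 < real n" "1 < real n * (b - y)"
      using xy by (linarith, simp add: field_simps)
    then have right_end: "y + 1 / real n < b"
      by (simp add: field_simps)
    show "(\<phi> n has_real_derivative \<phi>' n s) (at s)" for s
      unfolding \<phi>_def \<phi>'_def by (intro DERIV_diff scaled_ramp_derivative)
    show "continuous_on UNIV (\<phi>' n)"
      unfolding \<phi>'_def by (intro continuous_intros continuous_on_compose2[OF tent_continuous[of UNIV]]) auto
    have "\<phi> n s = 0" if "s \<notin> {x..y + 1 / real n}" for s
    proof -
    from that consider "s < x" | "y + 1 / real n < s"
      by fastforce
    then show ?thesis
    proof cases
      case 1
      then have "ramp (real n * (s - x)) = 0" "ramp (real n * (s - y)) = 0"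
        using xy by (auto intro!: ramp_left simp: mult_le_0_iff)
      then show ?thesis
        by (simp add: \<phi>_def)
    next
      case 2
      then have "1 \<le> real n * (s - y)"
        using n by (simp add: field_simps)
      moreover have "real n * (s - y) \<le> real n * (s - x)"
        using xy by (intro mult_left_mono) auto
      ultimately have "ramp (real n * (s - x)) = 1" "ramp (real n * (s - y)) = 1"
        by (auto intro!: ramp_right)
      then show ?thesis
        by (simp add: \<phi>_def)
    qed
    qed
    then show "\<exists>c d. a < c \<and> d < b \<and> (\<forall>s. s \<notin> {c..d} \<longrightarrow> \<phi> n s = 0)"
      using right_end xy by blast
  qed
  have cont_tent: "continuous_on {a..b} (\<lambda>s. real n * tent (real n * (s - c)))" for n c
    by (intro continuous_intros continuous_on_compose2[OF tent_continuous[of UNIV]]) auto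
  have int: "integrable ?M (\<lambda>s. f s * (real n * tent (real n * (s - c))))" for n c
    by (intro continuous_imp_integrable_real continuous_on_mult f cont_tent)
  have lim_f: "(\<lambda>n. LINT s|?M. f s * \<phi>' n s) \<longlonglongrightarrow> f x - f y"
    using tendsto_diff[OF tent_approximate_identity[OF f, of x] tent_approximate_identity[OF f, of y]] xy int
    by (simp add: \<phi>'_def right_diff_distrib)
  have lim_f': "(\<lambda>n. LINT s|?M. f' s * \<phi> n s) \<longlonglongrightarrow> (LINT s|?M. f' s * (indicator {x<..} s - indicator {y<..} s))"
  proof (rule integral_dominated_convergence[where w = "\<lambda>s. \<bar>f' s\<bar>"])
    have borel_id: "(\<lambda>s. s) \<in> borel_measurable ?M"
      by (rule continuous_imp_measurable_on_sets_lebesgue) (auto intro: continuous_intros)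
    then show "(\<lambda>s. f' s * (indicator {x<..} s - indicator {y<..} s)) \<in> borel_measurable ?M"
      using f' by (intro borel_measurable_times borel_measurable_diff) auto
    have "continuous_on {a..b} (\<phi> n)" for n
      unfolding \<phi>_def
      by (intro continuous_intros continuous_on_compose2[OF DERIV_continuous_on[of UNIV ramp tent]])
         (auto intro: ramp_derivative has_field_derivative_at_within)
    then show "(\<lambda>s. f' s * \<phi> n s) \<in> borel_measurable ?M" for n
      using f' continuous_imp_measurable_on_sets_lebesgue[of "{a..b}" "\<phi> n"]
      by (intro borel_measurable_times) auto
    show "integrable ?M (\<lambda>s. \<bar>f' s\<bar>)"
      using f' by simp
    show "AE s in ?M. (\<lambda>n. f' s * \<phi> n s) \<longlonglongrightarrow> f' s * (indicator {x<..} s - indicator {y<..} s)"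
      unfolding \<phi>_def by (intro AE_I2 tendsto_intros ramp_tendsto_indicator)
    have "\<bar>\<phi> n s\<bar> \<le> 1" for n s
      using ramp_bounds[of "real n * (s - x)"] ramp_bounds[of "real n * (s - y)"] by (simp add: \<phi>_def)
    then show "AE s in ?M. norm (f' s * \<phi> n s) \<le> \<bar>f' s\<bar>" for n
      by (intro AE_I2) (simp add: abs_mult mult_left_le)
  qed
  have "\<forall>\<^sub>F n in sequentially. (LINT s|?M. f s * \<phi>' n s) = - (LINT s|?M. f' s * \<phi> n s)"
    using assms(1) test by (auto simp: weak_deriv_def intro!: eventually_sequentiallyI[of N])
  then have lim: "(\<lambda>n. - (LINT s|?M. f' s * \<phi> n s)) \<longlonglongrightarrow> f x - f y"
    by (rule Lim_transform_eventually[OF lim_f])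
  have "f x - f y = - (LINT s|?M. f' s * (indicator {x<..} s - indicator {y<..} s))"
    by (rule LIMSEQ_unique[OF lim tendsto_minus[OF lim_f']])
  moreover have "(LINT s|?M. f' s * (indicator {x<..} s - indicator {y<..} s))
      = (LINT s|?M. indicator {..y} s * f' s - indicator {..x} s * f' s)"
    by (rule Bochner_Integration.integral_cong) (use xy in \<open>auto simp: indicator_def\<close>)
  moreover have "integrable ?M (\<lambda>s. indicator {..c} s * f' s)" for c
  proof -
    have "{..c} \<inter> {a..b} \<in> sets ?M"
      by (auto simp: sets_restrict_space)
    then have "integrable ?M (\<lambda>s. indicator ({..c} \<inter> {a..b}) s *\<^sub>R f' s)"
      by (rule integrable_mult_indicator[OF _ f'])
    also have "?this \<longleftrightarrow> ?thesis"
      by (rule Bochner_Integration.integrable_cong) (auto simp: indicator_def)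
    finally show ?thesis .
  qed
  ultimately show ?thesis
    using xy integral_upto_eq_indicator[of x b a f'] integral_upto_eq_indicator[of y b a f'] by simp
qed

text \<open>
  The increments are known in the open interval; continuity of \<open>f\<close> and of the indefinite integral
  carries the formula to the end points, so that the traces \<open>f a\<close> and \<open>f b\<close> may be used in integration
  by parts.
\<close>
lemma H1_primitive_on:
  assumes "H1 a b f f'" "a < b"
  shows "primitive_on a b f f'"
proof -
  have f: "continuous_on {a..b} f" and weak: "weak_deriv a b f f'" and int: "integrable (lebesgue_on {a..b}) f'"
    using assms(1) by (auto simp: H1_def intro: L2_integrable)
  define h where "h = (\<lambda>x. f x - (LINT s|lebesgue_on {a..x}. f' s))"
  define m where "m = (a + b) / 2"
  have m: "m \<in> {a<..<b}"
    using \<open>a < b\<close> by (auto simp: m_def)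
  have h_cont: "continuous_on {a..b} h"
    unfolding h_def by (intro continuous_intros f indefinite_integral_continuous_real int)
  have "h x = h m" if "x \<in> {a<..<b}" for x
    using weak_deriv_increment[OF weak f int, of x m] weak_deriv_increment[OF weak f int, of m x] that m
    by (cases "x \<le> m") (auto simp: h_def)
  then have const: "h x = h m" if "x \<in> {a..b}" for x
    using continuous_constant_on_closure[of "{a<..<b}" h "h m" x] h_cont that \<open>a < b\<close> by auto
  show ?thesis
  proof (rule primitive_onI[OF int])
    fix x assume "a \<le> x" "x \<le> b"
    moreover have "(LINT s|lebesgue_on {a..a}. f' s) = 0"
      using lebesgue_integral_eq_integral[OF integrable_subinterval[OF int, of a a]] \<open>a < b\<close> by simp
    ultimately show "(LINT s|lebesgue_on {a..x}. f' s) = f x - f a"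
      using const[of x] const[of a] by (auto simp: h_def)
  qed
qed

section \<open>Inequalities for the energy\<close>

text \<open>
  From \<open>f x = \<integral>\<^sub>a\<^sup>x f'\<close> and Cauchy-Schwarz, \<open>(f x)\<^sup>2 \<le> (x - a) \<integral> f'\<^sup>2\<close>.  Integrating the linear factor
  yields the \<open>1 / 2\<close>, which is what allows the heat part to decay at the rate \<open>4 \<kappa> / l1\<^sup>2\<close>.
\<close>
lemma primitive_on_Poincare:
  assumes f: "primitive_on a b f f'" "f' \<in> L2 a b" "f a = 0" and "a < b"
  shows "(LINT x|lebesgue_on {a..b}. (f x)\<^sup>2) \<le> (b - a)\<^sup>2 / 2 * (LINT x|lebesgue_on {a..b}. (f' x)\<^sup>2)"
proof -
  let ?S = "LINT x|lebesgue_on {a..b}. (f' x)\<^sup>2"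
  have sq: "integrable (lebesgue_on {a..b}) (\<lambda>x. (f' x)\<^sup>2)"
    using f(2) by (simp add: L2_def)
  have "(f x)\<^sup>2 \<le> (x - a) * ?S" if x: "x \<in> {a..b}" for x
  proof -
    have f'x: "f' \<in> L2 a x"
    proof -
      have "f' \<in> borel_measurable (lebesgue_on {a..x})"
        using integrable_subinterval[OF L2_integrable[OF f(2)], of a x] x by auto
      then show ?thesis
        using integrable_subinterval[OF sq, of a x] x by (auto simp: L2_def)
    qed
    have one: "(\<lambda>_. 1) \<in> L2 a x"
      by (simp add: L2_def)
    have "\<bar>f x\<bar> \<le> L2_norm a x (\<lambda>_. 1) * L2_norm a x f'"
      using L2_Cauchy_Schwarz[OF one f'x] f(1,3) x by (simp add: primitive_on_def)
    then have "\<bar>f x\<bar>\<^sup>2 \<le> (L2_norm a x (\<lambda>_. 1) * L2_norm a x f')\<^sup>2"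
      by (rule power_mono) simp
    then have "(f x)\<^sup>2 \<le> (x - a) * (LINT x|lebesgue_on {a..x}. (f' x)\<^sup>2)"
      using x by (simp add: power_mult_distrib L2_norm_power2 measure_restrict_space)
    also have "(LINT x|lebesgue_on {a..x}. (f' x)\<^sup>2) \<le> ?S"
    proof -
      have "?thesis \<longleftrightarrow> integral {a..x} (\<lambda>x. (f' x)\<^sup>2) \<le> integral {a..b} (\<lambda>x. (f' x)\<^sup>2)"
        using integrable_subinterval[OF sq, of a x] x by (simp add: lebesgue_integral_eq_integral sq)
      then show ?thesis
        using x integrable_on_lebesgue_on[OF sq] integrable_on_subinterval[of "\<lambda>x. (f' x)\<^sup>2" "{a..b}" a x]
        by (auto intro!: integral_subset_le)
    qed
    finally show ?thesis
      using x by (simp add: mult_left_mono)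
  qed
  moreover have fsq: "integrable (lebesgue_on {a..b}) (\<lambda>x. (f x)\<^sup>2)"
    by (intro continuous_imp_integrable_real continuous_intros primitive_on_continuous[OF f(1)])
  moreover have lin: "integrable (lebesgue_on {a..b}) (\<lambda>x. (x - a) * ?S)"
    by (intro continuous_imp_integrable_real continuous_intros)
  ultimately have "(LINT x|lebesgue_on {a..b}. (f x)\<^sup>2) \<le> (LINT x|lebesgue_on {a..b}. (x - a) * ?S)"
    by (intro integral_mono) auto
  also have "\<dots> = (b - a)\<^sup>2 / 2 * ?S"
  proof -
    have "((\<lambda>x. (x - a) * ?S) has_integral (b - a)\<^sup>2 / 2 * ?S - (a - a)\<^sup>2 / 2 * ?S) {a..b}"
    proof (rule fundamental_theorem_of_calculus)
      fix x
      have "((\<lambda>x. (x - a)\<^sup>2 / 2 * ?S) has_real_derivative (x - a) * ?S) (at x within {a..b})"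
        by (auto intro!: derivative_eq_intros)
      then show "((\<lambda>x. (x - a)\<^sup>2 / 2 * ?S) has_vector_derivative (x - a) * ?S) (at x within {a..b})"
        by (simp add: has_real_derivative_iff_has_vector_derivative)
    qed (use \<open>a < b\<close> in simp)
    then have "((\<lambda>x. (x - a) * ?S) has_integral (b - a)\<^sup>2 / 2 * ?S) {a..b}"
      by simp
    from integral_unique[OF this] show ?thesis
      by (simp only: lebesgue_integral_eq_integral[OF lin lmeasurable_interval(1)[THEN fmeasurableD]])
  qed
  finally show ?thesis .
qed

text \<open>
  Norms make the convergence of the energy along approximating solutions evident.
\<close>
lemma energy_eq_L2_norms:
  assumes "u1 t \<in> L2 0 l2" "u2 t \<in> L2 0 l2" "w1 t \<in> L2 0 l2" "w2 t \<in> L2 0 l2"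
  shows "energy l1 l2 \<rho> \<mu> \<alpha>1 \<beta> \<gamma> z u1 u2 w1 w2 t =
    1 / 2 * (L2_norm (- l1) 0 (z t))\<^sup>2 + 1 / 2 * (\<rho> * (L2_norm 0 l2 (w1 t))\<^sup>2 + \<mu> * (L2_norm 0 l2 (w2 t))\<^sup>2
      + \<alpha>1 * (L2_norm 0 l2 (u1 t))\<^sup>2 + \<beta> * (L2_norm 0 l2 (\<lambda>x. \<gamma> * u1 t x - u2 t x))\<^sup>2)"
proof -
  have heat: "(LINT x|lebesgue_on {0..l1}. (z t (- x))\<^sup>2) = (LINT x|lebesgue_on {- l1..0}. (z t x)\<^sup>2)"
    using integral_reflect_real[of 0 "- l1" "\<lambda>x. (z t x)\<^sup>2"] by simp
  have "(\<lambda>x. \<gamma> * u1 t x - u2 t x) \<in> L2 0 l2"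
    by (intro L2_diff L2_cmult assms)
  then show ?thesis
    unfolding energy_def power2_abs heat using assms by (simp add: L2_def L2_norm_power2)
qed

text \<open>
  The charge strain \<open>u2\<close> does not occur in the energy by itself, so it is replaced by
  \<open>\<gamma> u1 - (\<gamma> u1 - u2)\<close>.  Each of the three resulting products is then split by Young's inequality, and
  the coefficients of the same quadratic term are added up.
\<close>
lemma cross_term_le:
  fixes \<rho> \<mu> \<alpha>1 \<beta> \<gamma> m u1 u2 w1 w2 :: real
  assumes pos: "\<rho> > 0" "\<mu> > 0" "\<alpha>1 > 0" "\<beta> > 0" "\<gamma> > 0"
    and m: "sqrt (\<rho> / \<alpha>1) + sqrt (\<mu> * \<gamma>\<^sup>2 / \<alpha>1) \<le> m" "sqrt (\<mu> / \<beta>) + sqrt (\<mu> * \<gamma>\<^sup>2 / \<alpha>1) \<le> m"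
  shows "\<bar>\<rho> * w1 * u1 + \<mu> * w2 * u2\<bar>
    \<le> m / 2 * (\<rho> * w1\<^sup>2 + \<mu> * w2\<^sup>2 + \<alpha>1 * u1\<^sup>2 + \<beta> * (\<gamma> * u1 - u2)\<^sup>2)"
proof -
  \<comment> \<open>Young's inequality, balanced so that both sides carry their energy weight.\<close>
  have young: "\<bar>p * x * y\<bar> \<le> sqrt (p / q) / 2 * (p * x\<^sup>2 + q * y\<^sup>2)" if "0 < p" "0 < q" for p q x y :: real
  proof -
    have "2 * (sqrt p * \<bar>x\<bar>) * (sqrt q * \<bar>y\<bar>) \<le> (sqrt p * \<bar>x\<bar>)\<^sup>2 + (sqrt q * \<bar>y\<bar>)\<^sup>2"
      by (rule sum_squares_bound)
    then have "sqrt (p / q) / 2 * (2 * (sqrt p * \<bar>x\<bar>) * (sqrt q * \<bar>y\<bar>)) \<le> sqrt (p / q) / 2 * (p * x\<^sup>2 + q * y\<^sup>2)"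
      using that by (intro mult_left_mono) (auto simp: power_mult_distrib)
    moreover have "sqrt (p / q) / 2 * (2 * (sqrt p * \<bar>x\<bar>) * (sqrt q * \<bar>y\<bar>)) = \<bar>p * x * y\<bar>"
      using that by (simp add: real_sqrt_divide abs_mult)
    ultimately show ?thesis by simp
  qed
  define v where "v = \<gamma> * u1 - u2"
  have g: "\<bar>\<mu> * w2 * (\<gamma> * u1)\<bar> \<le> sqrt (\<mu> * \<gamma>\<^sup>2 / \<alpha>1) / 2 * (\<mu> * w2\<^sup>2 + \<alpha>1 * u1\<^sup>2)"
    using young[of \<mu> "\<alpha>1 / \<gamma>\<^sup>2" w2 "\<gamma> * u1"] pos by (simp add: power_mult_distrib)
  have "\<rho> * w1 * u1 + \<mu> * w2 * u2 = \<rho> * w1 * u1 + \<mu> * w2 * (\<gamma> * u1) - \<mu> * w2 * v"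
    by (simp add: v_def algebra_simps)
  then have "\<bar>\<rho> * w1 * u1 + \<mu> * w2 * u2\<bar> \<le> sqrt (\<rho> / \<alpha>1) / 2 * (\<rho> * w1\<^sup>2 + \<alpha>1 * u1\<^sup>2)
      + sqrt (\<mu> * \<gamma>\<^sup>2 / \<alpha>1) / 2 * (\<mu> * w2\<^sup>2 + \<alpha>1 * u1\<^sup>2) + sqrt (\<mu> / \<beta>) / 2 * (\<mu> * w2\<^sup>2 + \<beta> * v\<^sup>2)"
    using young[of \<rho> \<alpha>1 w1 u1] g young[of \<mu> \<beta> w2 v] pos by linarith
  also have "\<dots> = (sqrt (\<rho> / \<alpha>1) / 2) * (\<rho> * w1\<^sup>2) + ((sqrt (\<mu> / \<beta>) + sqrt (\<mu> * \<gamma>\<^sup>2 / \<alpha>1)) / 2) * (\<mu> * w2\<^sup>2)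
      + ((sqrt (\<rho> / \<alpha>1) + sqrt (\<mu> * \<gamma>\<^sup>2 / \<alpha>1)) / 2) * (\<alpha>1 * u1\<^sup>2) + (sqrt (\<mu> / \<beta>) / 2) * (\<beta> * v\<^sup>2)"
    by (simp add: field_simps)
  also have "\<dots> \<le> (m / 2) * (\<rho> * w1\<^sup>2) + (m / 2) * (\<mu> * w2\<^sup>2) + (m / 2) * (\<alpha>1 * u1\<^sup>2) + (m / 2) * (\<beta> * v\<^sup>2)"
  proof -
    have "0 \<le> sqrt (\<mu> * \<gamma>\<^sup>2 / \<alpha>1)"
      using pos by simp
    then have "sqrt (\<rho> / \<alpha>1) / 2 \<le> m / 2" "sqrt (\<mu> / \<beta>) / 2 \<le> m / 2"
      using m by linarith+
    then show ?thesis
      using m pos by (intro add_mono mult_right_mono) auto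
  qed
  finally show ?thesis
    by (simp add: v_def algebra_simps)
qed

text \<open>
  The stresses \<open>A\<close> and \<open>B\<close> determine the strains: \<open>\<alpha>1 u1 = A + \<gamma> B\<close> and \<open>\<beta> (\<gamma> u1 - u2) = - B\<close>.
\<close>
lemma boundary_strain_le:
  fixes \<alpha>1 \<alpha> \<beta> \<gamma> u1 u2 :: real
  assumes pos: "\<alpha>1 > 0" "\<beta> > 0" and \<alpha>: "\<alpha> = \<alpha>1 + \<gamma>\<^sup>2 * \<beta>"
    and A: "\<alpha> * u1 - \<gamma> * \<beta> * u2 = A" and B: "- \<gamma> * \<beta> * u1 + \<beta> * u2 = B"
  shows "\<alpha>1 * u1\<^sup>2 + \<beta> * (\<gamma> * u1 - u2)\<^sup>2 \<le> 2 / \<alpha>1 * A\<^sup>2 + (\<alpha> + \<gamma>\<^sup>2 * \<beta>) / (\<alpha>1 * \<beta>) * B\<^sup>2"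
proof -
  have u1: "\<alpha>1 * u1 = A + \<gamma> * B"
    using A B \<alpha> by (simp add: power2_eq_square algebra_simps flip: A B)
  have v: "\<beta> * (\<gamma> * u1 - u2) = - B"
    using B by (simp add: algebra_simps)
  have "\<alpha>1 * u1\<^sup>2 + \<beta> * (\<gamma> * u1 - u2)\<^sup>2 = (\<alpha>1 * u1)\<^sup>2 / \<alpha>1 + (\<beta> * (\<gamma> * u1 - u2))\<^sup>2 / \<beta>"
    using pos by (simp add: power2_eq_square)
  also have "\<dots> = (A + \<gamma> * B)\<^sup>2 / \<alpha>1 + B\<^sup>2 / \<beta>"
    by (simp add: u1 v)
  also have "\<dots> \<le> (2 * A\<^sup>2 + 2 * (\<gamma> * B)\<^sup>2) / \<alpha>1 + B\<^sup>2 / \<beta>"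
    using pos sum_squares_bound[of A "\<gamma> * B"] by (intro add_right_mono divide_right_mono) (auto simp: power2_sum)
  also have "\<dots> = 2 / \<alpha>1 * A\<^sup>2 + (\<alpha> + \<gamma>\<^sup>2 * \<beta>) / (\<alpha>1 * \<beta>) * B\<^sup>2"
    using pos by (simp add: \<alpha> field_simps)
  finally show ?thesis .
qed

section \<open>The Lyapunov functional\<close>

text \<open>
  The conditions on the parameters in the form in which the energy argument uses them.  In terms of the
  constants of the theorem, \<open>\<epsilon> = \<delta> a1\<close> is the size of the perturbation of the energy, \<open>m\<close> is the
  maximum that is the second factor of \<open>M'\<close>, \<open>\<theta> = M \<delta>\<close> bounds the distance of the perturbed functional
  from the energy relative to the energy, and at least the fraction \<open>r\<close> of the energy is dissipated per
  unit time.
\<close>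
locale decay_parameters =
  fixes l1 l2 \<kappa> \<rho> \<mu> \<alpha>1 \<alpha> \<beta> \<gamma> \<xi>1 \<xi>2 \<epsilon> m \<theta> r :: real
  assumes l1: "0 < l1" and l2: "0 < l2" and \<kappa>: "0 < \<kappa>" and pos: "0 < \<rho>" "0 < \<mu>" "0 < \<alpha>1" "0 < \<beta>" "0 < \<gamma>"
    and \<alpha>: "\<alpha> = \<alpha>1 + \<gamma>\<^sup>2 * \<beta>"
    and \<epsilon>: "0 < \<epsilon>"
    and m: "sqrt (\<rho> / \<alpha>1) + sqrt (\<mu> * \<gamma>\<^sup>2 / \<alpha>1) \<le> m" "sqrt (\<mu> / \<beta>) + sqrt (\<mu> * \<gamma>\<^sup>2 / \<alpha>1) \<le> m"
    and \<theta>: "\<theta> = \<epsilon> * l2 * m" "\<theta> < 1"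
    and gain1: "\<epsilon> * l2 * (\<rho> + \<xi>1\<^sup>2 * (2 / \<alpha>1)) \<le> 2 * \<xi>1"
    and gain2: "\<epsilon> * l2 * (\<mu> + \<xi>2\<^sup>2 * ((\<alpha> + \<gamma>\<^sup>2 * \<beta>) / (\<alpha>1 * \<beta>))) \<le> 2 * \<xi>2"
    and r: "0 \<le> r" "r \<le> \<epsilon>" "r \<le> 4 * \<kappa> / l1\<^sup>2"
begin

abbreviation "E \<equiv> energy l1 l2 \<rho> \<mu> \<alpha>1 \<beta> \<gamma>"

definition lyapunov :: "(real \<Rightarrow> real \<Rightarrow> real) \<Rightarrow> (real \<Rightarrow> real \<Rightarrow> real) \<Rightarrow> (real \<Rightarrow> real \<Rightarrow> real) \<Rightarrow>
    (real \<Rightarrow> real \<Rightarrow> real) \<Rightarrow> (real \<Rightarrow> real \<Rightarrow> real) \<Rightarrow> real \<Rightarrow> real" where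
  "lyapunov z u1 u2 w1 w2 t = E z u1 u2 w1 w2 t
     + \<epsilon> * (LINT x|lebesgue_on {0..l2}. x * (\<rho> * w1 t x * u1 t x + \<mu> * w2 t x * u2 t x))"

lemma m_nonneg: "0 \<le> m"
proof -
  have "0 \<le> sqrt (\<rho> / \<alpha>1) + sqrt (\<mu> * \<gamma>\<^sup>2 / \<alpha>1)"
    using pos by simp
  then show ?thesis
    using m by linarith
qed

lemma energy_nonneg: "0 \<le> E z u1 u2 w1 w2 t"
  unfolding energy_def using pos by (intro add_nonneg_nonneg mult_nonneg_nonneg Bochner_Integration.integral_nonneg) auto

lemma weighted_integrable:
  assumes "p \<in> L2 0 l2" "q \<in> L2 0 l2"
  shows "integrable (lebesgue_on {0..l2}) (\<lambda>x. x * (p x * q x))"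
proof -
  have "(\<lambda>x. x) \<in> borel_measurable (lebesgue_on {0..l2})"
    by (rule continuous_imp_measurable_on_sets_lebesgue) (auto intro: continuous_intros)
  from L2_mult_integrable[OF L2_bounded_mult[OF this _ assms(1), of l2] assms(2)] show ?thesis
    by (auto simp: mult.assoc)
qed

text \<open>
  The weight \<open>x\<close> is at most \<open>l2\<close>, so the cross term is at most \<open>\<epsilon> l2 m\<close> times the energy of the beam.
\<close>
lemma lyapunov_equivalent:
  assumes L: "u1 t \<in> L2 0 l2" "u2 t \<in> L2 0 l2" "w1 t \<in> L2 0 l2" "w2 t \<in> L2 0 l2"
  shows "\<bar>lyapunov z u1 u2 w1 w2 t - E z u1 u2 w1 w2 t\<bar> \<le> \<theta> * E z u1 u2 w1 w2 t"
proof -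
  let ?M = "lebesgue_on {0..l2}"
  let ?e = "\<lambda>x. \<rho> * (w1 t x)\<^sup>2 + \<mu> * (w2 t x)\<^sup>2 + \<alpha>1 * (u1 t x)\<^sup>2 + \<beta> * (\<gamma> * u1 t x - u2 t x)\<^sup>2"
  let ?c = "\<lambda>x. \<rho> * w1 t x * u1 t x + \<mu> * w2 t x * u2 t x"
  have "(\<lambda>x. \<gamma> * u1 t x - u2 t x) \<in> L2 0 l2"
    by (intro L2_diff L2_cmult L)
  then have e: "integrable ?M ?e"
    using L by (simp add: L2_def)
  have "integrable ?M (\<lambda>x. x * (\<rho> * w1 t x * u1 t x) + x * (\<mu> * w2 t x * u2 t x))"
    by (intro Bochner_Integration.integrable_add weighted_integrable L2_cmult L)
  then have c: "integrable ?M (\<lambda>x. x * ?c x)"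
    by (simp add: distrib_left)
  have "\<bar>LINT x|?M. x * ?c x\<bar> \<le> (LINT x|?M. l2 * (m / 2) * ?e x)"
    unfolding real_norm_def[symmetric]
  proof (rule Bochner_Integration.integral_norm_bound_integral)
    fix x assume "x \<in> space ?M"
    then have "\<bar>x\<bar> * \<bar>?c x\<bar> \<le> l2 * (m / 2 * ?e x)"
      using cross_term_le[OF pos m, of "w1 t x" "u1 t x" "w2 t x" "u2 t x"] by (intro mult_mono) auto
    then show "norm (x * ?c x) \<le> l2 * (m / 2) * ?e x"
      by (simp add: abs_mult mult.assoc)
  qed (use e c in auto)
  also have "\<dots> = l2 * m * (1 / 2 * (LINT x|?M. ?e x))"
    by simp
  also have "\<dots> \<le> l2 * m * E z u1 u2 w1 w2 t"
    using m_nonneg l2 unfolding energy_def power2_abs by (intro mult_left_mono) auto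
  finally have "\<epsilon> * \<bar>LINT x|?M. x * ?c x\<bar> \<le> \<epsilon> * (l2 * m * E z u1 u2 w1 w2 t)"
    using \<epsilon> by (intro mult_left_mono) auto
  then show ?thesis
    using \<epsilon> by (simp add: lyapunov_def abs_mult \<theta> mult.assoc)
qed

text \<open>
  The energy is a sum of inner products once its elastic part is written as
  \<open>\<alpha> u1\<^sup>2 - 2 \<gamma> \<beta> u1 u2 + \<beta> u2\<^sup>2\<close>; this is how the two stresses \<open>\<alpha> u1 - \<gamma> \<beta> u2\<close> and
  \<open>- \<gamma> \<beta> u1 + \<beta> u2\<close> of the equations of motion enter.
\<close>
lemma lyapunov_has_derivative:
  assumes z: "C1_L2 (- l1) 0 z zt" "C0_L2 (- l1) 0 z"
    and u1: "C1_L2 0 l2 u1 u1t" "C0_L2 0 l2 u1" and u2: "C1_L2 0 l2 u2 u2t" "C0_L2 0 l2 u2"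
    and w1: "C1_L2 0 l2 w1 w1t" "C0_L2 0 l2 w1" and w2: "C1_L2 0 l2 w2 w2t" "C0_L2 0 l2 w2"
    and t: "0 \<le> t"
  shows "(lyapunov z u1 u2 w1 w2 has_real_derivative
     (LINT x|lebesgue_on {- l1..0}. z t x * zt t x) +
     (LINT x|lebesgue_on {0..l2}. \<rho> * w1t t x * w1 t x + \<mu> * w2t t x * w2 t x
        + (\<alpha> * u1 t x - \<gamma> * \<beta> * u2 t x) * u1t t x + (- \<gamma> * \<beta> * u1 t x + \<beta> * u2 t x) * u2t t x
        + \<epsilon> * x * (\<rho> * w1t t x * u1 t x + \<rho> * w1 t x * u1t t x + \<mu> * w2t t x * u2 t x + \<mu> * w2 t x * u2t t x)))
     (at t within {0..})"
proof -
  let ?M = "lebesgue_on {0..l2}"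
  have mem: "u1 s \<in> L2 0 l2" "u2 s \<in> L2 0 l2" "w1 s \<in> L2 0 l2" "w2 s \<in> L2 0 l2" "z s \<in> L2 (- l1) 0"
    "u1t s \<in> L2 0 l2" "u2t s \<in> L2 0 l2" "w1t s \<in> L2 0 l2" "w2t s \<in> L2 0 l2" if "0 \<le> s" for s
    using that z u1 u2 w1 w2 by (auto simp: C1_L2_def C0_L2_def)
  define W where "W = (\<lambda>p q :: real \<Rightarrow> real. LINT x|?M. p x * q x)"
  define X where "X = (\<lambda>p q :: real \<Rightarrow> real. LINT x|?M. x * (p x * q x))"
  define Z where "Z = (\<lambda>s. LINT x|lebesgue_on {- l1..0}. z s x * z s x)"
  have dZ: "(Z has_real_derivative 2 * (LINT x|lebesgue_on {- l1..0}. z t x * zt t x)) (at t within {0..})"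
  proof -
    have "(\<lambda>x. zt t x * z t x + z t x * zt t x) = (\<lambda>x. 2 * (z t x * zt t x))"
      by auto
    then show ?thesis
      using C1_L2_weighted_product_derivative[of "\<lambda>_. 1" "- l1" 0 1, OF _ _ z z t] by (simp add: Z_def)
  qed
  have dW: "((\<lambda>s. W (f s) (g s)) has_real_derivative W (ft t) (g t) + W (f t) (gt t)) (at t within {0..})"
    if "C1_L2 0 l2 f ft" "C0_L2 0 l2 f" "C1_L2 0 l2 g gt" "C0_L2 0 l2 g" for f ft g gt
  proof -
    have "f t \<in> L2 0 l2" "ft t \<in> L2 0 l2" "g t \<in> L2 0 l2" "gt t \<in> L2 0 l2"
      using that t by (auto simp: C1_L2_def C0_L2_def)
    then show ?thesis
      using C1_L2_weighted_product_derivative[of "\<lambda>_. 1" 0 l2 1, OF _ _ that t]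
      by (simp add: W_def L2_mult_integrable)
  qed
  have dX: "((\<lambda>s. X (f s) (g s)) has_real_derivative X (ft t) (g t) + X (f t) (gt t)) (at t within {0..})"
    if "C1_L2 0 l2 f ft" "C0_L2 0 l2 f" "C1_L2 0 l2 g gt" "C0_L2 0 l2 g" for f ft g gt
  proof -
    have "f t \<in> L2 0 l2" "ft t \<in> L2 0 l2" "g t \<in> L2 0 l2" "gt t \<in> L2 0 l2"
      using that t by (auto simp: C1_L2_def C0_L2_def)
    moreover have "(\<lambda>x. x) \<in> borel_measurable ?M"
      by (rule continuous_imp_measurable_on_sets_lebesgue) (auto intro: continuous_intros)
    ultimately show ?thesis
      using C1_L2_weighted_product_derivative[of "\<lambda>x. x" 0 l2 l2, OF _ _ that t]
      by (simp add: X_def weighted_integrable mult.assoc)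
  qed
  have split: "lyapunov z u1 u2 w1 w2 s = 1 / 2 * Z s + \<rho> / 2 * W (w1 s) (w1 s) + \<mu> / 2 * W (w2 s) (w2 s)
      + \<alpha> / 2 * W (u1 s) (u1 s) - \<gamma> * \<beta> * W (u1 s) (u2 s) + \<beta> / 2 * W (u2 s) (u2 s)
      + \<epsilon> * \<rho> * X (w1 s) (u1 s) + \<epsilon> * \<mu> * X (w2 s) (u2 s)" if "0 \<le> s" for s
  proof -
    note L = mem[OF that]
    have Z: "(LINT x|lebesgue_on {0..l1}. (z s (- x))\<^sup>2) = Z s"
      using integral_reflect_real[of 0 "- l1" "\<lambda>x. (z s x)\<^sup>2"] by (simp add: Z_def power2_eq_square)
    have "(LINT x|?M. \<rho> * (w1 s x)\<^sup>2 + \<mu> * (w2 s x)\<^sup>2 + \<alpha>1 * (u1 s x)\<^sup>2 + \<beta> * (\<gamma> * u1 s x - u2 s x)\<^sup>2)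
      = (LINT x|?M. \<rho> * (w1 s x * w1 s x) + \<mu> * (w2 s x * w2 s x) + \<alpha> * (u1 s x * u1 s x)
          + (- 2 * \<gamma> * \<beta>) * (u1 s x * u2 s x) + \<beta> * (u2 s x * u2 s x))"
      by (rule Bochner_Integration.integral_cong) (simp_all add: \<alpha> power2_eq_square algebra_simps)
    also have "\<dots> = \<rho> * W (w1 s) (w1 s) + \<mu> * W (w2 s) (w2 s) + \<alpha> * W (u1 s) (u1 s)
        + (- 2 * \<gamma> * \<beta>) * W (u1 s) (u2 s) + \<beta> * W (u2 s) (u2 s)"
      using L by (simp add: W_def L2_mult_integrable)
    finally have W: "(LINT x|?M. \<rho> * (w1 s x)\<^sup>2 + \<mu> * (w2 s x)\<^sup>2 + \<alpha>1 * (u1 s x)\<^sup>2 + \<beta> * (\<gamma> * u1 s x - u2 s x)\<^sup>2) = \<dots>" .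
    have "(LINT x|?M. x * (\<rho> * w1 s x * u1 s x + \<mu> * w2 s x * u2 s x))
      = (LINT x|?M. \<rho> * (x * (w1 s x * u1 s x)) + \<mu> * (x * (w2 s x * u2 s x)))"
      by (rule Bochner_Integration.integral_cong) (simp_all add: algebra_simps)
    also have "\<dots> = \<rho> * X (w1 s) (u1 s) + \<mu> * X (w2 s) (u2 s)"
      using L by (simp add: X_def weighted_integrable)
    finally show ?thesis
      unfolding lyapunov_def energy_def power2_abs Z W by (simp add: field_simps)
  qed
  have deriv: "(lyapunov z u1 u2 w1 w2 has_real_derivative
      1 / 2 * (2 * (LINT x|lebesgue_on {- l1..0}. z t x * zt t x))
      + \<rho> / 2 * (W (w1t t) (w1 t) + W (w1 t) (w1t t)) + \<mu> / 2 * (W (w2t t) (w2 t) + W (w2 t) (w2t t))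
      + \<alpha> / 2 * (W (u1t t) (u1 t) + W (u1 t) (u1t t)) - \<gamma> * \<beta> * (W (u1t t) (u2 t) + W (u1 t) (u2t t))
      + \<beta> / 2 * (W (u2t t) (u2 t) + W (u2 t) (u2t t))
      + \<epsilon> * \<rho> * (X (w1t t) (u1 t) + X (w1 t) (u1t t)) + \<epsilon> * \<mu> * (X (w2t t) (u2 t) + X (w2 t) (u2t t)))
      (at t within {0..})"
  proof (rule has_field_derivative_transform_within[where d = 1])
    show "((\<lambda>s. 1 / 2 * Z s + \<rho> / 2 * W (w1 s) (w1 s) + \<mu> / 2 * W (w2 s) (w2 s)
      + \<alpha> / 2 * W (u1 s) (u1 s) - \<gamma> * \<beta> * W (u1 s) (u2 s) + \<beta> / 2 * W (u2 s) (u2 s)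
      + \<epsilon> * \<rho> * X (w1 s) (u1 s) + \<epsilon> * \<mu> * X (w2 s) (u2 s)) has_real_derivative
      1 / 2 * (2 * (LINT x|lebesgue_on {- l1..0}. z t x * zt t x))
      + \<rho> / 2 * (W (w1t t) (w1 t) + W (w1 t) (w1t t)) + \<mu> / 2 * (W (w2t t) (w2 t) + W (w2 t) (w2t t))
      + \<alpha> / 2 * (W (u1t t) (u1 t) + W (u1 t) (u1t t)) - \<gamma> * \<beta> * (W (u1t t) (u2 t) + W (u1 t) (u2t t))
      + \<beta> / 2 * (W (u2t t) (u2 t) + W (u2 t) (u2t t))
      + \<epsilon> * \<rho> * (X (w1t t) (u1 t) + X (w1 t) (u1t t)) + \<epsilon> * \<mu> * (X (w2t t) (u2 t) + X (w2 t) (u2t t)))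
      (at t within {0..})"
      by (intro DERIV_add DERIV_diff DERIV_cmult dZ dW dX u1 u2 w1 w2)
  qed (use t split in auto)
  have "(LINT x|?M. \<rho> * w1t t x * w1 t x + \<mu> * w2t t x * w2 t x
        + (\<alpha> * u1 t x - \<gamma> * \<beta> * u2 t x) * u1t t x + (- \<gamma> * \<beta> * u1 t x + \<beta> * u2 t x) * u2t t x
        + \<epsilon> * x * (\<rho> * w1t t x * u1 t x + \<rho> * w1 t x * u1t t x + \<mu> * w2t t x * u2 t x + \<mu> * w2 t x * u2t t x))
    = (LINT x|?M. \<rho> * (w1t t x * w1 t x) + \<mu> * (w2t t x * w2 t x)
        + \<alpha> * (u1 t x * u1t t x) - \<gamma> * \<beta> * (u1t t x * u2 t x) - \<gamma> * \<beta> * (u1 t x * u2t t x) + \<beta> * (u2 t x * u2t t x)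
        + \<epsilon> * \<rho> * (x * (w1t t x * u1 t x)) + \<epsilon> * \<rho> * (x * (w1 t x * u1t t x))
        + \<epsilon> * \<mu> * (x * (w2t t x * u2 t x)) + \<epsilon> * \<mu> * (x * (w2 t x * u2t t x)))"
    by (rule Bochner_Integration.integral_cong) (simp_all add: algebra_simps)
  also have "\<dots> = \<rho> * W (w1t t) (w1 t) + \<mu> * W (w2t t) (w2 t)
        + \<alpha> * W (u1 t) (u1t t) - \<gamma> * \<beta> * W (u1t t) (u2 t) - \<gamma> * \<beta> * W (u1 t) (u2t t) + \<beta> * W (u2 t) (u2t t)
        + \<epsilon> * \<rho> * X (w1t t) (u1 t) + \<epsilon> * \<rho> * X (w1 t) (u1t t) + \<epsilon> * \<mu> * X (w2t t) (u2 t) + \<epsilon> * \<mu> * X (w2 t) (u2t t)"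
    unfolding W_def X_def using mem[OF t] by (simp add: L2_mult_integrable weighted_integrable)
  finally have integral: "(LINT x|?M. \<rho> * w1t t x * w1 t x + \<mu> * w2t t x * w2 t x
        + (\<alpha> * u1 t x - \<gamma> * \<beta> * u2 t x) * u1t t x + (- \<gamma> * \<beta> * u1 t x + \<beta> * u2 t x) * u2t t x
        + \<epsilon> * x * (\<rho> * w1t t x * u1 t x + \<rho> * w1 t x * u1t t x + \<mu> * w2t t x * u2 t x + \<mu> * w2 t x * u2t t x))
      = \<dots>" .
  have sym: "W (w1 t) (w1t t) = W (w1t t) (w1 t)" "W (w2 t) (w2t t) = W (w2t t) (w2 t)"
    "W (u1t t) (u1 t) = W (u1 t) (u1t t)" "W (u2t t) (u2 t) = W (u2 t) (u2t t)"
    by (simp_all add: W_def mult.commute)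
  show ?thesis
    unfolding integral by (rule DERIV_cong[OF deriv]) (unfold sym, simp add: field_simps)
qed


text \<open>
  With time derivatives expressed through space derivatives, the integrand is the derivative of the power
  flux (stress times velocity) plus \<open>\<epsilon> / 2\<close> times \<open>x e'\<close>, where \<open>e\<close> is twice the energy density.
  Since \<open>x e' = (x e)' - e\<close>, the multiplier \<open>x\<close> produces the damping term \<open>- \<epsilon> / 2 \<integral> e\<close>; as it vanishes
  at \<open>0\<close>, its boundary term sits at the controlled end \<open>l2\<close> only.
\<close>
lemma beam_identity:
  assumes u1: "primitive_on 0 l2 u1 u1x" and u2: "primitive_on 0 l2 u2 u2x"
    and w1: "primitive_on 0 l2 w1 w1x" and w2: "primitive_on 0 l2 w2 w2x"
  shows "(LINT x|lebesgue_on {0..l2}.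
        (\<alpha> * u1x x - \<gamma> * \<beta> * u2x x) * w1 x + (- \<gamma> * \<beta> * u1x x + \<beta> * u2x x) * w2 x
        + (\<alpha> * u1 x - \<gamma> * \<beta> * u2 x) * w1x x + (- \<gamma> * \<beta> * u1 x + \<beta> * u2 x) * w2x x
        + \<epsilon> * x * ((\<alpha> * u1x x - \<gamma> * \<beta> * u2x x) * u1 x + \<rho> * w1 x * w1x x
          + (- \<gamma> * \<beta> * u1x x + \<beta> * u2x x) * u2 x + \<mu> * w2 x * w2x x))
    = (\<alpha> * u1 l2 - \<gamma> * \<beta> * u2 l2) * w1 l2 + (- \<gamma> * \<beta> * u1 l2 + \<beta> * u2 l2) * w2 l2
      - (\<alpha> * u1 0 - \<gamma> * \<beta> * u2 0) * w1 0 - (- \<gamma> * \<beta> * u1 0 + \<beta> * u2 0) * w2 0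
      + \<epsilon> * l2 / 2 * (\<rho> * (w1 l2)\<^sup>2 + \<mu> * (w2 l2)\<^sup>2 + \<alpha>1 * (u1 l2)\<^sup>2 + \<beta> * (\<gamma> * u1 l2 - u2 l2)\<^sup>2)
      - \<epsilon> / 2 * (LINT x|lebesgue_on {0..l2}.
          \<rho> * (w1 x)\<^sup>2 + \<mu> * (w2 x)\<^sup>2 + \<alpha>1 * (u1 x)\<^sup>2 + \<beta> * (\<gamma> * u1 x - u2 x)\<^sup>2)"
proof -
  let ?M = "lebesgue_on {0..l2}"
  let ?e = "\<lambda>x. \<rho> * (w1 x)\<^sup>2 + \<mu> * (w2 x)\<^sup>2 + \<alpha>1 * (u1 x)\<^sup>2 + \<beta> * (\<gamma> * u1 x - u2 x)\<^sup>2"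
  define A where "A = (\<lambda>x. \<alpha> * u1 x + (- \<gamma> * \<beta>) * u2 x)"
  define A' where "A' = (\<lambda>x. \<alpha> * u1x x + (- \<gamma> * \<beta>) * u2x x)"
  define B where "B = (\<lambda>x. (- \<gamma> * \<beta>) * u1 x + \<beta> * u2 x)"
  define B' where "B' = (\<lambda>x. (- \<gamma> * \<beta>) * u1x x + \<beta> * u2x x)"
  have A: "primitive_on 0 l2 A A'" and B: "primitive_on 0 l2 B B'"
    unfolding A_def A'_def B_def B'_def by (intro primitive_on_add primitive_on_cmult u1 u2)+
  define flux' where "flux' = (\<lambda>x. A' x * w1 x + A x * w1x x + (B' x * w2 x + B x * w2x x))"
  have flux: "primitive_on 0 l2 (\<lambda>x. A x * w1 x + B x * w2 x) flux'"
    unfolding flux'_def by (intro primitive_on_add primitive_on_mult A B w1 w2)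
  \<comment> \<open>the energy density, written through the stresses so that it is a sum of products\<close>
  define e' where "e' = (\<lambda>x. \<rho> * (w1x x * w1 x + w1 x * w1x x) + \<mu> * (w2x x * w2 x + w2 x * w2x x)
      + ((A' x * u1 x + A x * u1x x) + (B' x * u2 x + B x * u2x x)))"
  have e_eq: "?e x = \<rho> * (w1 x * w1 x) + \<mu> * (w2 x * w2 x) + (A x * u1 x + B x * u2 x)" for x
    by (simp add: A_def B_def \<alpha> power2_eq_square algebra_simps)
  have e: "primitive_on 0 l2 ?e e'"
    unfolding e_eq e'_def by (intro primitive_on_add primitive_on_cmult primitive_on_mult A B u1 u2 w1 w2)
  have xe: "primitive_on 0 l2 (\<lambda>x. x * ?e x) (\<lambda>x. 1 * ?e x + x * e' x)"
    by (rule primitive_on_mult[OF primitive_on_ident e])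
  have int: "integrable ?M flux'" "integrable ?M (\<lambda>x. ?e x + x * e' x)" "integrable ?M ?e"
    using flux xe continuous_imp_integrable_real[OF primitive_on_continuous[OF e]] by (simp_all add: primitive_on_def)
  have "(LINT x|?M. (\<alpha> * u1x x - \<gamma> * \<beta> * u2x x) * w1 x + (- \<gamma> * \<beta> * u1x x + \<beta> * u2x x) * w2 x
        + (\<alpha> * u1 x - \<gamma> * \<beta> * u2 x) * w1x x + (- \<gamma> * \<beta> * u1 x + \<beta> * u2 x) * w2x x
        + \<epsilon> * x * ((\<alpha> * u1x x - \<gamma> * \<beta> * u2x x) * u1 x + \<rho> * w1 x * w1x x
          + (- \<gamma> * \<beta> * u1x x + \<beta> * u2x x) * u2 x + \<mu> * w2 x * w2x x))
      = (LINT x|?M. flux' x + \<epsilon> / 2 * (?e x + x * e' x) - \<epsilon> / 2 * ?e x)"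
    by (rule Bochner_Integration.integral_cong)
       (simp_all add: flux'_def e'_def A_def A'_def B_def B'_def field_simps)
  also have "\<dots> = (LINT x|?M. flux' x) + \<epsilon> / 2 * (LINT x|?M. ?e x + x * e' x) - \<epsilon> / 2 * (LINT x|?M. ?e x)"
    using int by (simp only: Bochner_Integration.integral_add Bochner_Integration.integral_diff
        Bochner_Integration.integrable_add integrable_mult_right integral_mult_right_zero)
  also have "(LINT x|?M. flux' x) = (A l2 * w1 l2 + B l2 * w2 l2) - (A 0 * w1 0 + B 0 * w2 0)"
    using primitive_on_end[OF flux] l2 by simp
  also have "(LINT x|?M. ?e x + x * e' x) = l2 * ?e l2"
    using primitive_on_end[OF xe] l2 by simp
  finally show ?thesis
    by (simp add: A_def B_def field_simps)
qed

section \<open>Dissipation along classical solutions\<close>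

lemma heat_dissipation:
  assumes z: "H1 (- l1) 0 z zx" and zx: "H1 (- l1) 0 zx zxx" and "z (- l1) = 0"
  shows "\<kappa> * (LINT x|lebesgue_on {- l1..0}. z x * zxx x)
    \<le> \<kappa> * zx 0 * z 0 - r / 2 * (LINT x|lebesgue_on {- l1..0}. (z x)\<^sup>2)"
proof -
  let ?M = "lebesgue_on {- l1..0}"
  have l1': "- l1 < 0"
    using l1 by simp
  note p = H1_primitive_on[OF z l1'] H1_primitive_on[OF zx l1']
  have mem: "z \<in> L2 (- l1) 0" "zx \<in> L2 (- l1) 0" "zxx \<in> L2 (- l1) 0"
    using z zx by (auto simp: H1_def)
  have int: "integrable ?M (\<lambda>x. (zx x)\<^sup>2)" "integrable ?M (\<lambda>x. z x * zxx x)"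
    using mem by (simp_all add: L2_def L2_mult_integrable)
  have "(LINT x|?M. (zx x)\<^sup>2) + (LINT x|?M. z x * zxx x) = zx 0 * z 0"
    using primitive_on_end[OF primitive_on_mult[OF p]] l1 int assms(3)
    by (simp add: power2_eq_square mult.commute)
  then have parts: "(LINT x|?M. z x * zxx x) = zx 0 * z 0 - (LINT x|?M. (zx x)\<^sup>2)"
    by linarith
  have "r / 2 * (LINT x|?M. (z x)\<^sup>2) \<le> (4 * \<kappa> / l1\<^sup>2) / 2 * (LINT x|?M. (z x)\<^sup>2)"
    using r by (intro mult_right_mono divide_right_mono) auto
  also have "\<dots> \<le> (4 * \<kappa> / l1\<^sup>2) / 2 * (l1\<^sup>2 / 2 * (LINT x|?M. (zx x)\<^sup>2))"
    using primitive_on_Poincare[OF p(1) mem(2) assms(3) l1'] l1 \<kappa> by (intro mult_left_mono) auto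
  also have "\<dots> = \<kappa> * (LINT x|?M. (zx x)\<^sup>2)"
    using l1 by simp
  finally show ?thesis
    by (simp add: parts algebra_simps)
qed

text \<open>
  The multiplier creates the boundary energy \<open>\<epsilon> l2 e l2 / 2\<close>.  Under the feedback it is a quadratic form
  in the boundary velocities, and the conditions on \<open>\<epsilon>\<close> say that the feedback absorbs it.
\<close>
lemma boundary_dissipation:
  assumes b1: "\<alpha> * u1 - \<gamma> * \<beta> * u2 = - \<xi>1 * w1" and b2: "- \<gamma> * \<beta> * u1 + \<beta> * u2 = - \<xi>2 * w2"
  shows "(\<alpha> * u1 - \<gamma> * \<beta> * u2) * w1 + (- \<gamma> * \<beta> * u1 + \<beta> * u2) * w2
    + \<epsilon> * l2 / 2 * (\<rho> * w1\<^sup>2 + \<mu> * w2\<^sup>2 + \<alpha>1 * u1\<^sup>2 + \<beta> * (\<gamma> * u1 - u2)\<^sup>2) \<le> 0"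
proof -
  let ?q = "(\<alpha> + \<gamma>\<^sup>2 * \<beta>) / (\<alpha>1 * \<beta>)"
  have "\<rho> * w1\<^sup>2 + \<mu> * w2\<^sup>2 + \<alpha>1 * u1\<^sup>2 + \<beta> * (\<gamma> * u1 - u2)\<^sup>2
      \<le> (\<rho> + \<xi>1\<^sup>2 * (2 / \<alpha>1)) * w1\<^sup>2 + (\<mu> + \<xi>2\<^sup>2 * ?q) * w2\<^sup>2"
    using boundary_strain_le[OF pos(3,4) \<alpha> b1 b2] by (simp add: power_mult_distrib algebra_simps)
  then have "\<epsilon> * l2 / 2 * (\<rho> * w1\<^sup>2 + \<mu> * w2\<^sup>2 + \<alpha>1 * u1\<^sup>2 + \<beta> * (\<gamma> * u1 - u2)\<^sup>2)
      \<le> \<epsilon> * l2 / 2 * ((\<rho> + \<xi>1\<^sup>2 * (2 / \<alpha>1)) * w1\<^sup>2 + (\<mu> + \<xi>2\<^sup>2 * ?q) * w2\<^sup>2)"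
    using \<epsilon> l2 by (intro mult_left_mono) auto
  also have "\<dots> = (\<epsilon> * l2 * (\<rho> + \<xi>1\<^sup>2 * (2 / \<alpha>1))) / 2 * w1\<^sup>2 + (\<epsilon> * l2 * (\<mu> + \<xi>2\<^sup>2 * ?q)) / 2 * w2\<^sup>2"
    by (simp add: algebra_simps add_divide_distrib)
  also have "\<dots> \<le> (2 * \<xi>1) / 2 * w1\<^sup>2 + (2 * \<xi>2) / 2 * w2\<^sup>2"
    using gain1 gain2 by (intro add_mono mult_right_mono divide_right_mono) auto
  finally show ?thesis
    unfolding b1 b2 by (simp add: power2_eq_square)
qed

text \<open>
  At the interface the heat flux times the temperature, \<open>\<kappa> zx z\<close>, equals the power that leaves the
  beam, so these two terms cancel.  What is left is bounded by \<open>- r\<close> times the heat energy by Poincare's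
  inequality and by \<open>- \<epsilon>\<close> times the beam energy by the multiplier.  The equations hold for positive times,
  while the derivative at time zero is kept to have continuity up to the initial time.
\<close>
lemma lyapunov_dissipation:
  assumes sol: "classical_solution l1 l2 \<kappa> \<rho> \<mu> \<alpha> \<beta> \<gamma> \<xi>1 \<xi>2 z u1 u2 w1 w2" and t: "0 \<le> t"
  shows "\<exists>D. (lyapunov z u1 u2 w1 w2 has_real_derivative D) (at t within {0..})
     \<and> (0 < t \<longrightarrow> D \<le> - r * E z u1 u2 w1 w2 t)"
proof -
  from sol obtain zt zx zxx u1t u1x u2t u2x w1t w1x w2t w2x where
    C1: "C1_L2 (- l1) 0 z zt" "C1_L2 0 l2 u1 u1t" "C1_L2 0 l2 u2 u2t" "C1_L2 0 l2 w1 w1t" "C1_L2 0 l2 w2 w2t"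
    and C0: "C0_H2 (- l1) 0 z zx zxx" "C0_H1 0 l2 u1 u1x" "C0_H1 0 l2 u2 u2x" "C0_H1 0 l2 w1 w1x" "C0_H1 0 l2 w2 w2x"
    and pde: "\<forall>t>0.
          (AE x in lebesgue_on {- l1..0}. zt t x = \<kappa> * zxx t x) \<and>
          (AE x in lebesgue_on {0..l2}. u1t t x = w1x t x) \<and>
          (AE x in lebesgue_on {0..l2}. u2t t x = w2x t x) \<and>
          (AE x in lebesgue_on {0..l2}. \<rho> * w1t t x = \<alpha> * u1x t x - \<gamma> * \<beta> * u2x t x) \<and>
          (AE x in lebesgue_on {0..l2}. \<mu> * w2t t x = - \<gamma> * \<beta> * u1x t x + \<beta> * u2x t x) \<and>
          z t (- l1) = 0 \<and> w2 t 0 = 0 \<and> z t 0 = w1 t 0 \<and>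
          \<kappa> * zx t 0 = \<alpha> * u1 t 0 - \<gamma> * \<beta> * u2 t 0 \<and>
          \<alpha> * u1 t l2 - \<gamma> * \<beta> * u2 t l2 = - \<xi>1 * w1 t l2 \<and>
          - \<gamma> * \<beta> * u1 t l2 + \<beta> * u2 t l2 = - \<xi>2 * w2 t l2"
    unfolding classical_solution_def by blast
  have C0_L2: "C0_L2 (- l1) 0 z" "C0_L2 0 l2 u1" "C0_L2 0 l2 u2" "C0_L2 0 l2 w1" "C0_L2 0 l2 w2"
    using C0 by (auto simp: C0_H2_def C0_H1_def)
  have H1: "H1 (- l1) 0 (z t) (zx t)" "H1 (- l1) 0 (zx t) (zxx t)" "H1 0 l2 (u1 t) (u1x t)" "H1 0 l2 (u2 t) (u2x t)"
    "H1 0 l2 (w1 t) (w1x t)" "H1 0 l2 (w2 t) (w2x t)"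
    using C0 t by (auto simp: C0_H2_def C0_H1_def)
  let ?M = "lebesgue_on {0..l2}"
  let ?e = "\<lambda>x. \<rho> * (w1 t x)\<^sup>2 + \<mu> * (w2 t x)\<^sup>2 + \<alpha>1 * (u1 t x)\<^sup>2 + \<beta> * (\<gamma> * u1 t x - u2 t x)\<^sup>2"
  let ?f = "\<lambda>x. \<rho> * w1t t x * w1 t x + \<mu> * w2t t x * w2 t x
        + (\<alpha> * u1 t x - \<gamma> * \<beta> * u2 t x) * u1t t x + (- \<gamma> * \<beta> * u1 t x + \<beta> * u2 t x) * u2t t x
        + \<epsilon> * x * (\<rho> * w1t t x * u1 t x + \<rho> * w1 t x * u1t t x + \<mu> * w2t t x * u2 t x + \<mu> * w2 t x * u2t t x)"
  let ?g = "\<lambda>x. (\<alpha> * u1x t x - \<gamma> * \<beta> * u2x t x) * w1 t x + (- \<gamma> * \<beta> * u1x t x + \<beta> * u2x t x) * w2 t x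
        + (\<alpha> * u1 t x - \<gamma> * \<beta> * u2 t x) * w1x t x + (- \<gamma> * \<beta> * u1 t x + \<beta> * u2 t x) * w2x t x
        + \<epsilon> * x * ((\<alpha> * u1x t x - \<gamma> * \<beta> * u2x t x) * u1 t x + \<rho> * w1 t x * w1x t x
          + (- \<gamma> * \<beta> * u1x t x + \<beta> * u2x t x) * u2 t x + \<mu> * w2 t x * w2x t x)"
  have "(LINT x|lebesgue_on {- l1..0}. z t x * zt t x) + (LINT x|?M. ?f x) \<le> - r * E z u1 u2 w1 w2 t" if "0 < t"
  proof -
    have ae: "AE x in lebesgue_on {- l1..0}. zt t x = \<kappa> * zxx t x"
      "AE x in ?M. u1t t x = w1x t x" "AE x in ?M. u2t t x = w2x t x"
      "AE x in ?M. \<rho> * w1t t x = \<alpha> * u1x t x - \<gamma> * \<beta> * u2x t x"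
      "AE x in ?M. \<mu> * w2t t x = - \<gamma> * \<beta> * u1x t x + \<beta> * u2x t x"
      and bc: "z t (- l1) = 0" "w2 t 0 = 0" "z t 0 = w1 t 0" "\<kappa> * zx t 0 = \<alpha> * u1 t 0 - \<gamma> * \<beta> * u2 t 0"
      "\<alpha> * u1 t l2 - \<gamma> * \<beta> * u2 t l2 = - \<xi>1 * w1 t l2"
      "- \<gamma> * \<beta> * u1 t l2 + \<beta> * u2 t l2 = - \<xi>2 * w2 t l2"
      using pde[rule_format, OF that] by - (elim conjE, assumption)+
    note borel = L2_def[THEN equalityD1, THEN subsetD, THEN CollectD, THEN conjunct1]
    have mem: "z t \<in> L2 (- l1) 0" "zxx t \<in> L2 (- l1) 0" "u1 t \<in> L2 0 l2" "u2 t \<in> L2 0 l2" "w1 t \<in> L2 0 l2" "w2 t \<in> L2 0 l2"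
      "u1x t \<in> L2 0 l2" "u2x t \<in> L2 0 l2" "w1x t \<in> L2 0 l2" "w2x t \<in> L2 0 l2"
      using H1 by (simp_all add: H1_def)
    have mem': "zt t \<in> L2 (- l1) 0" "u1t t \<in> L2 0 l2" "u2t t \<in> L2 0 l2" "w1t t \<in> L2 0 l2" "w2t t \<in> L2 0 l2"
      using C1 t by (simp_all add: C1_L2_def C0_L2_def)
    note [measurable] = mem[THEN borel] mem'[THEN borel]
    have [measurable]: "(\<lambda>x. x) \<in> borel_measurable ?M"
      by (rule continuous_imp_measurable_on_sets_lebesgue) (auto intro: continuous_intros)
    have "(LINT x|lebesgue_on {- l1..0}. z t x * zt t x) = (LINT x|lebesgue_on {- l1..0}. \<kappa> * (z t x * zxx t x))"
    proof (rule integral_cong_AE)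
      show "AE x in lebesgue_on {- l1..0}. z t x * zt t x = \<kappa> * (z t x * zxx t x)"
        using ae(1) by eventually_elim simp
    qed measurable
    then have heat: "(LINT x|lebesgue_on {- l1..0}. z t x * zt t x)
        \<le> \<kappa> * zx t 0 * z t 0 - r / 2 * (LINT x|lebesgue_on {- l1..0}. (z t x)\<^sup>2)"
      using heat_dissipation[OF H1(1,2) bc(1)] by simp
    have "(LINT x|?M. ?f x) = (LINT x|?M. ?g x)"
    proof (rule integral_cong_AE)
      show "AE x in ?M. ?f x = ?g x"
        using ae(2-5) by eventually_elim simp
    qed measurable
    also have "\<dots> = (\<alpha> * u1 t l2 - \<gamma> * \<beta> * u2 t l2) * w1 t l2 + (- \<gamma> * \<beta> * u1 t l2 + \<beta> * u2 t l2) * w2 t l2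
      - (\<alpha> * u1 t 0 - \<gamma> * \<beta> * u2 t 0) * w1 t 0 - (- \<gamma> * \<beta> * u1 t 0 + \<beta> * u2 t 0) * w2 t 0
      + \<epsilon> * l2 / 2 * ?e l2 - \<epsilon> / 2 * (LINT x|?M. ?e x)"
      by (rule beam_identity[OF H1_primitive_on[OF H1(3) l2] H1_primitive_on[OF H1(4) l2]
            H1_primitive_on[OF H1(5) l2] H1_primitive_on[OF H1(6) l2]])
    also have "\<dots> \<le> - \<kappa> * zx t 0 * z t 0 - \<epsilon> / 2 * (LINT x|?M. ?e x)"
    proof -
      have "(\<alpha> * u1 t 0 - \<gamma> * \<beta> * u2 t 0) * w1 t 0 = \<kappa> * zx t 0 * z t 0"
        by (simp only: bc)
      moreover have "(- \<gamma> * \<beta> * u1 t 0 + \<beta> * u2 t 0) * w2 t 0 = 0"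
        by (simp add: bc(2))
      ultimately show ?thesis
        using boundary_dissipation[OF bc(5,6)] by linarith
    qed
    also have "\<dots> \<le> - \<kappa> * zx t 0 * z t 0 - r / 2 * (LINT x|?M. ?e x)"
      using r pos by (intro diff_left_mono mult_right_mono divide_right_mono Bochner_Integration.integral_nonneg) auto
    finally have beam: "(LINT x|?M. ?f x) \<le> - \<kappa> * zx t 0 * z t 0 - r / 2 * (LINT x|?M. ?e x)" .
    have reflect: "(LINT x|lebesgue_on {0..l1}. (z t (- x))\<^sup>2) = (LINT x|lebesgue_on {- l1..0}. (z t x)\<^sup>2)"
      using integral_reflect_real[of 0 "- l1" "\<lambda>x. (z t x)\<^sup>2"] by simp
    show ?thesis
      using heat beam unfolding energy_def power2_abs reflect by (simp add: algebra_simps)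
  qed
  then show ?thesis
    using lyapunov_has_derivative[OF C1(1) C0_L2(1) C1(2) C0_L2(2) C1(3) C0_L2(3) C1(4) C0_L2(4) C1(5) C0_L2(5) t]
    by (intro exI[of _ "(LINT x|lebesgue_on {- l1..0}. z t x * zt t x) + (LINT x|?M. ?f x)"] conjI impI)
qed

text \<open>
  The functional \<open>V\<close> lies between \<open>(1 - \<theta>) E\<close> and \<open>(1 + \<theta>) E\<close>, and \<open>exp (r (1 - \<theta>) t) V\<close> does not
  increase.
\<close>
lemma classical_energy_decay:
  assumes sol: "classical_solution l1 l2 \<kappa> \<rho> \<mu> \<alpha> \<beta> \<gamma> \<xi>1 \<xi>2 z u1 u2 w1 w2" and t: "0 \<le> t"
  shows "E z u1 u2 w1 w2 t \<le> (1 + \<theta>) / (1 - \<theta>) * exp (- (r * (1 - \<theta>)) * t) * E z u1 u2 w1 w2 0"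
proof -
  let ?V = "lyapunov z u1 u2 w1 w2" and ?E = "E z u1 u2 w1 w2"
  define \<sigma> where "\<sigma> = r * (1 - \<theta>)"
  have mem: "u1 s \<in> L2 0 l2 \<and> u2 s \<in> L2 0 l2 \<and> w1 s \<in> L2 0 l2 \<and> w2 s \<in> L2 0 l2" if "0 \<le> s" for s
    using sol that by (auto simp: classical_solution_def C1_L2_def)
  have equiv: "(1 - \<theta>) * ?E s \<le> ?V s" "?V s \<le> (1 + \<theta>) * ?E s" if "0 \<le> s" for s
    using lyapunov_equivalent[of u1 s u2 w1 w2 z] mem[OF that] by (auto simp: algebra_simps)
  have derivative: "((\<lambda>s. exp (\<sigma> * s) * ?V s) has_real_derivative exp (\<sigma> * s) * (D + \<sigma> * ?V s)) (at s within {0..})"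
    if "(?V has_real_derivative D) (at s within {0..})" for s D
    using that by (auto intro!: derivative_eq_intros simp: algebra_simps)
  have "exp (\<sigma> * t) * ?V t \<le> exp (\<sigma> * 0) * ?V 0"
  proof (rule DERIV_nonpos_imp_decreasing_open[OF t, of "\<lambda>s. exp (\<sigma> * s) * ?V s"])
    have "((\<lambda>s. exp (\<sigma> * s) * ?V s) has_real_derivative (exp (\<sigma> * s) * ((SOME D. (?V has_real_derivative D) (at s within {0..})) + \<sigma> * ?V s)))
        (at s within {0..})" if "0 \<le> s" for s
      using lyapunov_dissipation[OF sol that] by (intro derivative) (metis someI)
    then show "continuous_on {0..t} (\<lambda>s. exp (\<sigma> * s) * ?V s)"
      by (intro DERIV_continuous_on[THEN continuous_on_subset[of "{0..}"]]) auto
    fix s assume s: "0 < s" "s < t"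
    then obtain D where D: "(?V has_real_derivative D) (at s within {0..})" "D \<le> - r * ?E s"
      using lyapunov_dissipation[OF sol, of s] by auto
    have "at s within {0..} = at s"
      using s by (intro at_within_interior) simp
    then have "((\<lambda>s. exp (\<sigma> * s) * ?V s) has_real_derivative exp (\<sigma> * s) * (D + \<sigma> * ?V s)) (at s)"
      using derivative[OF D(1)] by simp
    \<comment> \<open>\<open>(1 - \<theta>) * (1 + \<theta>) \<le> 1\<close> turns the rate against the energy into one against the functional\<close>
    moreover have "\<sigma> * ?V s \<le> r * ?E s"
    proof -
      have "\<sigma> * ?V s \<le> \<sigma> * ((1 + \<theta>) * ?E s)"
        using equiv(2)[of s] s r(1) \<theta>(2) by (intro mult_left_mono) (auto simp: \<sigma>_def)
      also have "\<dots> = r * ((1 - \<theta>\<^sup>2) * ?E s)"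
        by (simp add: \<sigma>_def power2_eq_square algebra_simps)
      also have "\<dots> \<le> r * (1 * ?E s)"
        using r(1) energy_nonneg by (intro mult_left_mono mult_right_mono) auto
      finally show ?thesis by simp
    qed
    ultimately show "\<exists>y. ((\<lambda>s. exp (\<sigma> * s) * ?V s) has_real_derivative y) (at s) \<and> y \<le> 0"
      using D(2) by (intro exI conjI) (auto simp: mult_le_0_iff)
  qed
  then have "?V t \<le> exp (- \<sigma> * t) * ?V 0"
    by (simp add: exp_minus field_simps)
  also have "\<dots> \<le> exp (- \<sigma> * t) * ((1 + \<theta>) * ?E 0)"
    using equiv(2)[of 0] by simp
  finally have "(1 - \<theta>) * ?E t \<le> exp (- \<sigma> * t) * ((1 + \<theta>) * ?E 0)"
    using equiv(1)[OF t] by linarith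
  then show ?thesis
    using \<theta>(2) by (simp add: \<sigma>_def field_simps)
qed

end

section \<open>Limits of classical solutions\<close>

lemma L2_norm_tendsto:
  assumes "(\<lambda>n. L2_norm a b (\<lambda>x. F n x - f x)) \<longlonglongrightarrow> 0" "\<And>n. F n \<in> L2 a b" "f \<in> L2 a b"
  shows "(\<lambda>n. L2_norm a b (F n)) \<longlonglongrightarrow> L2_norm a b f"
proof (rule LIM_zero_cancel, rule Lim_null_comparison[OF _ assms(1)])
  show "\<forall>\<^sub>F n in sequentially. norm (L2_norm a b (F n) - L2_norm a b f) \<le> L2_norm a b (\<lambda>x. F n x - f x)"
    by (simp add: L2_norm_diff_le assms(2,3))
qed

lemma L2_norm_le_H_norm:
  "L2_norm (- l1) 0 z \<le> H_norm l1 l2 z u1 u2 w1 w2" "L2_norm 0 l2 u1 \<le> H_norm l1 l2 z u1 u2 w1 w2"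
  "L2_norm 0 l2 u2 \<le> H_norm l1 l2 z u1 u2 w1 w2" "L2_norm 0 l2 w1 \<le> H_norm l1 l2 z u1 u2 w1 w2"
  "L2_norm 0 l2 w2 \<le> H_norm l1 l2 z u1 u2 w1 w2"
  unfolding H_norm_def by (rule real_le_rsqrt; simp)+

text \<open>
  The energy is a continuous quadratic form on the energy space.
\<close>
lemma energy_tendsto:
  assumes lim: "(\<lambda>n. H_norm l1 l2 (\<lambda>x. Z n t x - z t x) (\<lambda>x. U1 n t x - u1 t x) (\<lambda>x. U2 n t x - u2 t x)
                     (\<lambda>x. W1 n t x - w1 t x) (\<lambda>x. W2 n t x - w2 t x)) \<longlonglongrightarrow> 0"
    and Z: "\<And>n. Z n t \<in> L2 (- l1) 0" and U1: "\<And>n. U1 n t \<in> L2 0 l2" and U2: "\<And>n. U2 n t \<in> L2 0 l2"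
    and W1: "\<And>n. W1 n t \<in> L2 0 l2" and W2: "\<And>n. W2 n t \<in> L2 0 l2"
    and z: "z t \<in> L2 (- l1) 0" and u1: "u1 t \<in> L2 0 l2" and u2: "u2 t \<in> L2 0 l2"
    and w1: "w1 t \<in> L2 0 l2" and w2: "w2 t \<in> L2 0 l2"
  shows "(\<lambda>n. energy l1 l2 \<rho> \<mu> \<alpha>1 \<beta> \<gamma> (Z n) (U1 n) (U2 n) (W1 n) (W2 n) t)
    \<longlonglongrightarrow> energy l1 l2 \<rho> \<mu> \<alpha>1 \<beta> \<gamma> z u1 u2 w1 w2 t"
proof -
  have component: "(\<lambda>n. L2_norm a b (f n)) \<longlonglongrightarrow> 0"
    if "\<And>n. L2_norm a b (f n) \<le> H_norm l1 l2 (\<lambda>x. Z n t x - z t x) (\<lambda>x. U1 n t x - u1 t x) (\<lambda>x. U2 n t x - u2 t x)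
                     (\<lambda>x. W1 n t x - w1 t x) (\<lambda>x. W2 n t x - w2 t x)" for a b f
    by (rule Lim_null_comparison[OF always_eventually lim]) (simp add: L2_norm_nonneg that)
  note z_lim = component[OF L2_norm_le_H_norm(1)]
  note u1_lim = component[OF L2_norm_le_H_norm(2)]
  note u2_lim = component[OF L2_norm_le_H_norm(3)]
  note w1_lim = component[OF L2_norm_le_H_norm(4)]
  note w2_lim = component[OF L2_norm_le_H_norm(5)]
  have v_lim: "(\<lambda>n. L2_norm 0 l2 (\<lambda>x. (\<gamma> * U1 n t x - U2 n t x) - (\<gamma> * u1 t x - u2 t x))) \<longlonglongrightarrow> 0"
  proof (rule Lim_null_comparison)
    show "\<forall>\<^sub>F n in sequentially. norm (L2_norm 0 l2 (\<lambda>x. (\<gamma> * U1 n t x - U2 n t x) - (\<gamma> * u1 t x - u2 t x)))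
        \<le> \<bar>\<gamma>\<bar> * L2_norm 0 l2 (\<lambda>x. U1 n t x - u1 t x) + \<bar>-1\<bar> * L2_norm 0 l2 (\<lambda>x. U2 n t x - u2 t x)"
    proof (intro always_eventually allI)
      fix n
      have "(\<lambda>x. (\<gamma> * U1 n t x - U2 n t x) - (\<gamma> * u1 t x - u2 t x))
          = (\<lambda>x. \<gamma> * (U1 n t x - u1 t x) + (-1) * (U2 n t x - u2 t x))"
        by (auto simp: algebra_simps)
      then show "norm (L2_norm 0 l2 (\<lambda>x. (\<gamma> * U1 n t x - U2 n t x) - (\<gamma> * u1 t x - u2 t x)))
        \<le> \<bar>\<gamma>\<bar> * L2_norm 0 l2 (\<lambda>x. U1 n t x - u1 t x) + \<bar>-1\<bar> * L2_norm 0 l2 (\<lambda>x. U2 n t x - u2 t x)"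
        using L2_norm_triangle[OF L2_cmult[OF L2_diff[OF U1 u1], of \<gamma> n] L2_cmult[OF L2_diff[OF U2 u2], of "-1" n]]
        by (simp only: L2_norm_cmult real_norm_def abs_of_nonneg[OF L2_norm_nonneg])
    qed
    show "(\<lambda>n. \<bar>\<gamma>\<bar> * L2_norm 0 l2 (\<lambda>x. U1 n t x - u1 t x) + \<bar>-1\<bar> * L2_norm 0 l2 (\<lambda>x. U2 n t x - u2 t x)) \<longlonglongrightarrow> 0"
      using tendsto_add[OF tendsto_mult_left[OF u1_lim, of "\<bar>\<gamma>\<bar>"] tendsto_mult_left[OF u2_lim, of "\<bar>-1\<bar>"]] by simp
  qed
  have V: "(\<lambda>x. \<gamma> * U1 n t x - U2 n t x) \<in> L2 0 l2" for n
    by (intro L2_diff L2_cmult U1 U2)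
  have v: "(\<lambda>x. \<gamma> * u1 t x - u2 t x) \<in> L2 0 l2"
    by (intro L2_diff L2_cmult u1 u2)
  show ?thesis
    unfolding energy_eq_L2_norms[of "U1 n" t l2 "U2 n" "W1 n" "W2 n" for n, OF U1 U2 W1 W2]
      energy_eq_L2_norms[of u1 t l2 u2 w1 w2, OF u1 u2 w1 w2]
    by (intro tendsto_intros L2_norm_tendsto z_lim u1_lim w1_lim w2_lim v_lim Z U1 W1 W2 V z u1 w1 w2 v)
qed

context decay_parameters begin

theorem energy_decay:
  assumes sol: "solution l1 l2 \<kappa> \<rho> \<mu> \<alpha> \<beta> \<gamma> \<xi>1 \<xi>2 z u1 u2 w1 w2" and t: "0 < t"
  shows "E z u1 u2 w1 w2 t \<le> (1 + \<theta>) / (1 - \<theta>) * exp (- (r * (1 - \<theta>)) * t) * E z u1 u2 w1 w2 0"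
  using sol unfolding solution_def
proof (elim disjE conjE exE)
  assume "classical_solution l1 l2 \<kappa> \<rho> \<mu> \<alpha> \<beta> \<gamma> \<xi>1 \<xi>2 z u1 u2 w1 w2"
  then show ?thesis
    using t by (intro classical_energy_decay) auto
next
  fix Z U1 U2 W1 W2 :: "nat \<Rightarrow> real \<Rightarrow> real \<Rightarrow> real"
  assume L2: "\<forall>t\<ge>0. z t \<in> L2 (- l1) 0 \<and> u1 t \<in> L2 0 l2 \<and> u2 t \<in> L2 0 l2 \<and> w1 t \<in> L2 0 l2 \<and> w2 t \<in> L2 0 l2"
    and classical: "\<forall>n. classical_solution l1 l2 \<kappa> \<rho> \<mu> \<alpha> \<beta> \<gamma> \<xi>1 \<xi>2 (Z n) (U1 n) (U2 n) (W1 n) (W2 n)"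
    and lim: "\<forall>T>0. uniform_limit {0..T} (\<lambda>n t. H_norm l1 l2 (\<lambda>x. Z n t x - z t x)
                     (\<lambda>x. U1 n t x - u1 t x) (\<lambda>x. U2 n t x - u2 t x)
                     (\<lambda>x. W1 n t x - w1 t x) (\<lambda>x. W2 n t x - w2 t x)) (\<lambda>t. 0) sequentially"
  have energy_lim: "(\<lambda>n. E (Z n) (U1 n) (U2 n) (W1 n) (W2 n) s) \<longlonglongrightarrow> E z u1 u2 w1 w2 s" if s: "0 \<le> s" "s \<le> t" for s
  proof (rule energy_tendsto)
    show "(\<lambda>n. H_norm l1 l2 (\<lambda>x. Z n s x - z s x) (\<lambda>x. U1 n s x - u1 s x) (\<lambda>x. U2 n s x - u2 s x)
                     (\<lambda>x. W1 n s x - w1 s x) (\<lambda>x. W2 n s x - w2 s x)) \<longlonglongrightarrow> 0"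
      by (rule tendsto_uniform_limitI[OF lim[rule_format, OF t]]) (use s in simp)
    have "Z n s \<in> L2 (- l1) 0 \<and> U1 n s \<in> L2 0 l2 \<and> U2 n s \<in> L2 0 l2 \<and> W1 n s \<in> L2 0 l2 \<and> W2 n s \<in> L2 0 l2" for n
      using classical[rule_format, of n] s by (auto simp: classical_solution_def C1_L2_def)
    then show "Z n s \<in> L2 (- l1) 0" "U1 n s \<in> L2 0 l2" "U2 n s \<in> L2 0 l2" "W1 n s \<in> L2 0 l2" "W2 n s \<in> L2 0 l2" for n
      by auto
  qed (use L2 s in auto)
  show ?thesis
  proof (rule LIMSEQ_le[OF energy_lim tendsto_mult_left[OF energy_lim]])
    show "\<exists>N. \<forall>n\<ge>N. E (Z n) (U1 n) (U2 n) (W1 n) (W2 n) t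
        \<le> (1 + \<theta>) / (1 - \<theta>) * exp (- (r * (1 - \<theta>)) * t) * E (Z n) (U1 n) (U2 n) (W1 n) (W2 n) 0"
      using classical_energy_decay classical t by auto
  qed (use t in auto)
qed

end

section \<open>The decay rate\<close>

text \<open>
  What remains is to check that the constants meet the conditions of the energy argument.  The bound
  \<open>r \<le> 4 \<kappa> / l1\<^sup>2\<close>, that is \<open>2 \<delta> b1 l2 \<le> 1\<close>, is hidden in the condition on the first gain:
  \<open>2 \<xi>1 / (\<rho> + 2 \<xi>1\<^sup>2 / \<alpha>1) \<le> sqrt (\<alpha>1 / \<rho>)\<close> for every \<open>\<xi>1\<close>, and \<open>a1\<close> contains \<open>2 b1\<close> times this
  wave speed.
\<close>
theorem theorem5:
  fixes l1 l2 \<kappa> \<rho> \<mu> \<alpha>1 \<alpha> \<beta> \<gamma> \<xi>1 \<xi>2 b1 a1 M M' \<delta> \<sigma> :: real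
    and z u1 u2 w1 w2 :: "real \<Rightarrow> real \<Rightarrow> real"
  assumes "l1 > 0" "l2 > 0" "\<kappa> > 0" "\<rho> > 0" "\<mu> > 0" "\<alpha>1 > 0" "\<beta> > 0" "\<gamma> > 0"
    and "\<alpha> = \<alpha>1 + \<gamma>\<^sup>2 * \<beta>"
    and "\<xi>1 > 0" "\<xi>2 > 0" "b1 > 0"
    and "a1 = 2 * b1 * (4 * l2 * \<kappa> / l1\<^sup>2 +
           max (sqrt (\<alpha>1 / \<rho>) + \<gamma>\<^sup>2 * sqrt (\<beta> * \<mu>) / \<rho>) (2 * sqrt (\<beta> / \<mu>)))"
    and "M' = (8 * l2 * \<kappa> / l1\<^sup>2 +
           2 * max (sqrt (\<alpha>1 / \<rho>) + \<gamma>\<^sup>2 * sqrt (\<beta> * \<mu>) / \<rho>) (2 * sqrt (\<beta> / \<mu>))) *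
         Max {sqrt (\<rho> / \<alpha>1) + sqrt (\<mu> * \<gamma>\<^sup>2 / \<alpha>1),
              sqrt (\<mu> / \<beta>) + sqrt (\<mu> * \<gamma>\<^sup>2 / \<alpha>1),
              2,
              \<alpha> / \<alpha>1 + \<gamma>\<^sup>2 * \<beta> / (2 * \<alpha>1)}"
    and "M = b1 * l2 * M'"
    and "\<delta> > 0"
    and "\<delta> < Min {1 / M,
                  2 * \<xi>1 / (a1 * l2 * (\<rho> + \<xi>1\<^sup>2 * (2 / \<alpha>1))),
                  2 * \<xi>2 / (a1 * l2 * (\<mu> + \<xi>2\<^sup>2 * ((\<alpha> + \<gamma>\<^sup>2 * \<beta>) / (\<alpha>1 * \<beta>))))}"
    and "\<sigma> = \<delta> * (1 - M * \<delta>) * (8 * b1 * l2 * \<kappa> / l1\<^sup>2)"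
    and "solution l1 l2 \<kappa> \<rho> \<mu> \<alpha> \<beta> \<gamma> \<xi>1 \<xi>2 z u1 u2 w1 w2"
  shows "\<forall>t>0. energy l1 l2 \<rho> \<mu> \<alpha>1 \<beta> \<gamma> z u1 u2 w1 w2 t
           \<le> (1 + M * \<delta>) / (1 - M * \<delta>) * exp (- \<sigma> * t)
               * energy l1 l2 \<rho> \<mu> \<alpha>1 \<beta> \<gamma> z u1 u2 w1 w2 0"
proof -
  note pos = assms(1-8,10-12)
  define speed where "speed = max (sqrt (\<alpha>1 / \<rho>) + \<gamma>\<^sup>2 * sqrt (\<beta> * \<mu>) / \<rho>) (2 * sqrt (\<beta> / \<mu>))"
  define S where "S = {sqrt (\<rho> / \<alpha>1) + sqrt (\<mu> * \<gamma>\<^sup>2 / \<alpha>1), sqrt (\<mu> / \<beta>) + sqrt (\<mu> * \<gamma>\<^sup>2 / \<alpha>1), 2,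
              \<alpha> / \<alpha>1 + \<gamma>\<^sup>2 * \<beta> / (2 * \<alpha>1)}"
  define r where "r = \<delta> * (8 * b1 * l2 * \<kappa> / l1\<^sup>2)"
  have speed: "sqrt (\<alpha>1 / \<rho>) \<le> speed"
    using pos by (auto simp: speed_def le_max_iff_disj)
  moreover have sound: "0 < sqrt (\<alpha>1 / \<rho>)"
    using pos by simp
  ultimately have speed_pos: "0 < speed"
    by linarith
  have a1: "a1 = b1 * (8 * l2 * \<kappa> / l1\<^sup>2 + 2 * speed)"
    unfolding assms(13) speed_def[symmetric] by (simp add: algebra_simps)
  then have a1_pos: "0 < a1"
    using pos speed_pos by (simp add: add_pos_pos)
  have M: "M = a1 * l2 * Max S"
    unfolding assms(14,15) a1 S_def speed_def by simp
  have "2 \<le> Max S"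
    by (rule Max_ge) (auto simp: S_def)
  then have M_pos: "0 < M"
    using a1_pos pos by (simp add: M)
  have \<delta>: "\<delta> < 1 / M" "\<delta> < 2 * \<xi>1 / (a1 * l2 * (\<rho> + \<xi>1\<^sup>2 * (2 / \<alpha>1)))"
    "\<delta> < 2 * \<xi>2 / (a1 * l2 * (\<mu> + \<xi>2\<^sup>2 * ((\<alpha> + \<gamma>\<^sup>2 * \<beta>) / (\<alpha>1 * \<beta>))))"
    using assms(17) by simp_all
  have \<alpha>_pos: "0 < \<alpha> + \<gamma>\<^sup>2 * \<beta>"
    using pos by (simp add: assms(9) add_pos_pos)
  have gain1: "\<delta> * (a1 * l2 * (\<rho> + \<xi>1\<^sup>2 * (2 / \<alpha>1))) < 2 * \<xi>1"
    using \<delta>(2) a1_pos pos by (simp add: pos_less_divide_eq add_pos_pos)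
  have gain2: "\<delta> * (a1 * l2 * (\<mu> + \<xi>2\<^sup>2 * ((\<alpha> + \<gamma>\<^sup>2 * \<beta>) / (\<alpha>1 * \<beta>)))) < 2 * \<xi>2"
    using \<delta>(3) a1_pos pos \<alpha>_pos by (simp add: pos_less_divide_eq add_pos_pos)
  have small: "2 * \<delta> * b1 * l2 \<le> 1"
  proof -
    define s where "s = sqrt (\<alpha>1 / \<rho>)"
    have s: "0 < s" "s\<^sup>2 = \<alpha>1 / \<rho>"
      using sound pos by (simp_all add: s_def)
    \<comment> \<open>the factor \<open>a1\<close> dominates \<open>2 b1 s\<close>, and the other one \<open>2 \<xi>1 / s\<close> by the AM-GM inequality\<close>
    have "2 * \<xi>1 * (2 * \<delta> * b1 * l2) = \<delta> * (2 * b1 * s * l2 * (2 * \<xi>1 / s))"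
      using s by simp
    also have "\<dots> \<le> \<delta> * (a1 * l2 * (\<rho> + \<xi>1\<^sup>2 * (2 / \<alpha>1)))"
    proof (intro mult_left_mono mult_mono)
      show "2 * b1 * s \<le> a1"
      proof -
        have "b1 * (0 + 2 * s) \<le> b1 * (8 * l2 * \<kappa> / l1\<^sup>2 + 2 * speed)"
          using speed pos by (intro mult_left_mono add_mono) (auto simp: s_def)
        then show ?thesis
          by (simp add: a1)
      qed
      have "2 * 1 * (\<xi>1 / s / \<rho>) \<le> 1\<^sup>2 + (\<xi>1 / s / \<rho>)\<^sup>2"
        by (rule sum_squares_bound)
      then have "\<rho> * (2 * (\<xi>1 / s / \<rho>)) \<le> \<rho> * (1 + (\<xi>1 / s / \<rho>)\<^sup>2)"
        using pos by (intro mult_left_mono) auto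
      also have "\<rho> * (1 + (\<xi>1 / s / \<rho>)\<^sup>2) = \<rho> + \<xi>1\<^sup>2 * (1 / \<alpha>1)"
        using pos by (simp only: power_divide s(2)) (simp add: field_simps power2_eq_square)
      also have "\<dots> \<le> \<rho> + \<xi>1\<^sup>2 * (2 / \<alpha>1)"
        using pos by (intro add_left_mono mult_left_mono divide_right_mono) auto
      finally show "2 * \<xi>1 / s \<le> \<rho> + \<xi>1\<^sup>2 * (2 / \<alpha>1)"
        using pos by simp
    qed (use pos s a1_pos assms(16) in auto)
    also have "\<dots> \<le> 2 * \<xi>1 * 1"
      using gain1 by simp
    finally show ?thesis
      using pos by simp
  qed
  interpret decay_parameters l1 l2 \<kappa> \<rho> \<mu> \<alpha>1 \<alpha> \<beta> \<gamma> \<xi>1 \<xi>2 "\<delta> * a1" "Max S" "M * \<delta>" r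
  proof
    show "sqrt (\<rho> / \<alpha>1) + sqrt (\<mu> * \<gamma>\<^sup>2 / \<alpha>1) \<le> Max S" "sqrt (\<mu> / \<beta>) + sqrt (\<mu> * \<gamma>\<^sup>2 / \<alpha>1) \<le> Max S"
      by (auto simp: S_def intro!: Max_ge)
    show "M * \<delta> < 1"
      using \<delta>(1) M_pos by (simp add: field_simps)
    show "0 \<le> r"
      using pos assms(16) by (simp add: r_def)
    show "r \<le> \<delta> * a1"
    proof -
      have "\<delta> * a1 = r + \<delta> * (b1 * (2 * speed))"
        by (simp add: r_def a1 algebra_simps)
      then show ?thesis
        using pos assms(16) speed_pos by simp
    qed
    have "r = (2 * \<delta> * b1 * l2) * (4 * \<kappa> / l1\<^sup>2)"
      by (simp add: r_def)
    also have "\<dots> \<le> 1 * (4 * \<kappa> / l1\<^sup>2)"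
      using small pos by (intro mult_right_mono) auto
    finally show "r \<le> 4 * \<kappa> / l1\<^sup>2"
      by simp
  qed (use pos assms(9,16) a1_pos gain1 gain2 M in \<open>auto simp: mult_ac\<close>)
  have "r * (1 - M * \<delta>) = \<sigma>"
    by (simp add: r_def assms(18))
  then show ?thesis
    using energy_decay[OF assms(19)] by simp
qed

end
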